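(* Let $r\in\mathbb{N}$ be a positive integer and $b\ge 2$ a squarefree integer such that $P(X)=X^3+3rbX-b\in\mathbb{Z}[X]$ is monogenic, let $\theta$ be the real zero of $P(X)$, and let $L=\mathbb{Q}(\theta)$ be the simply real cubic number field generated by it. The two-sided chain $(\nu^i(1))_{i\in\mathbb{Z}}$ of lattice minima $\nu^i(1)\in\mathrm{Min}(\mathcal{O}_L)$ is - an $\mathrm{M}2$-chain, if $r\ge b\cdot\sqrt[3]{b^2/4}\ \left(>\sqrt[3]{b/4}\right)$, and - at least an $\mathrm{M}1$-chain (possibly even an $\mathrm{M}2$-chain), if $r\ge\sqrt[3]{b/4}$.
   Context: $P$ is monogenic if it is irreducible and $\mathbb{Z}[\theta]=\mathcal{O}_L$. For $\alpha\in L\subset\mathbb{R}$ let $\alpha',\alpha''$ be the two complex conjugates, so $\alpha'\alpha''=|\alpha'|^2$. A lattice minimum of $\mathcal{O}_L$ is an element $\alpha\in\mathcal{O}_L$, $\alpha>0$, such that no non-zero $\nu\in\mathcal{O}_L$ satisfies $|\nu|<\alpha$ and $\nu'\nu''<\alpha'\alpha''$; $\mathrm{Min}(\mathcal{O}_L)$ is the set of these. For $\alpha\in\mathrm{Min}(\mathcal{O}_L)$, $\nu(\alpha)$ denotes the lattice minimum with the largest real value smaller than $\alpha$; $\nu$ is a bijection and $\mathrm{Min}(\mathcal{O}_L)=\{\nu^i(1):i\in\mathbb{Z}\}$. The group $U_L^+$ of positive units of $\mathcal{O}_L$ acts on $\mathrm{Min}(\mathcal{O}_L)$ by multiplication. A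 non-unitary differential principal factor is a non-unit $\alpha\in\mathcal{O}_L$ generating an ambiguous ideal, i.e. $\alpha^3/\mathrm{N}_{L/\mathbb{Q}}(\alpha)$ is a unit, and such that $\alpha\mathcal{O}_L$ is not generated by a rational number. The chain is an $\mathrm{M}2$-, $\mathrm{M}1$-, $\mathrm{M}0$-chain if $\mathrm{Min}(\mathcal{O}_L)$ contains exactly $2$, $1$, $0$ orbits, respectively, of non-unitary differential principal factors; "at least an $\mathrm{M}1$-chain" means an $\mathrm{M}1$- or an $\mathrm{M}2$-chain. *)

theory Defs
  imports Complex_Main "HOL-Computational_Algebra.Computational_Algebra"
begin

definition is_subfield :: "real set \<Rightarrow> bool" where
  "is_subfield K \<longleftrightarrow>
     1 \<in> K \<and>
     (\<forall>x\<in>K. \<forall>y\<in>K. x - y \<in> K \<and> x * y \<in> K) \<and>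
     (\<forall>x\<in>K. inverse x \<in> K)"

definition rat_adjoin :: "real \<Rightarrow> real set" where
  "rat_adjoin \<theta> = \<Inter>{K. is_subfield K \<and> \<theta> \<in> K}"

definition int_adjoin :: "real \<Rightarrow> real set" where
  "int_adjoin \<theta> = range (\<lambda>q :: int poly. poly (map_poly of_int q) \<theta>)"

definition ring_of_integers :: "real set \<Rightarrow> real set" where
  "ring_of_integers K = {x \<in> K. algebraic_int x}"

(* An integer polynomial P together with the chosen zero theta of P. *)
definition monogenic :: "int poly \<Rightarrow> real \<Rightarrow> bool" where
  "monogenic P \<theta> \<longleftrightarrow> irreducible P \<and> int_adjoin \<theta> = ring_of_integers (rat_adjoin \<theta>)"

definition nonreal_embedding :: "real set \<Rightarrow> (real \<Rightarrow> complex) \<Rightarrow> bool" where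
  "nonreal_embedding K \<sigma> \<longleftrightarrow>
     \<sigma> 1 = 1 \<and>
     (\<forall>x\<in>K. \<forall>y\<in>K. \<sigma> (x + y) = \<sigma> x + \<sigma> y \<and> \<sigma> (x * y) = \<sigma> x * \<sigma> y) \<and>
     (\<exists>x\<in>K. \<sigma> x \<notin> \<real>)"

(* A cubic field K with exactly one real embedding has two embeddings with non-real
   image, and they are complex conjugates of each other. Hence the choice decides only which
   conjugate of x is called x' and which x''; conj_norm below does not depend on it. *)
definition conjugate :: "real set \<Rightarrow> real \<Rightarrow> complex" where
  "conjugate K = (SOME \<sigma>. nonreal_embedding K \<sigma>)"

(* x' x'' = |x'|^2, as x'' is the complex conjugate of x'. *)
definition conj_norm :: "real set \<Rightarrow> real \<Rightarrow> real" where
  "conj_norm K x = (cmod (conjugate K x))\<^sup>2"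

(* The norm of K over the rationals as the product x x' x''. *)
definition field_norm :: "real set \<Rightarrow> real \<Rightarrow> real" where
  "field_norm K x = x * conj_norm K x"

definition int_units :: "real set \<Rightarrow> real set" where
  "int_units K = {u \<in> ring_of_integers K. u \<noteq> 0 \<and> inverse u \<in> ring_of_integers K}"

definition pos_units :: "real set \<Rightarrow> real set" where
  "pos_units K = {u \<in> int_units K. u > 0}"

definition lattice_minima :: "real set \<Rightarrow> real set" where
  "lattice_minima K = {\<alpha> \<in> ring_of_integers K. \<alpha> > 0 \<and>
     \<not> (\<exists>\<nu> \<in> ring_of_integers K. \<nu> \<noteq> 0 \<and> \<bar>\<nu>\<bar> < \<alpha> \<and> conj_norm K \<nu> < conj_norm K \<alpha>)}"

definition next_minimum :: "real set \<Rightarrow> real \<Rightarrow> real" where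
  "next_minimum K \<alpha> = (GREATEST \<beta>. \<beta> \<in> lattice_minima K \<and> \<beta> < \<alpha>)"

definition minima_chain :: "real set \<Rightarrow> int \<Rightarrow> real" where
  "minima_chain K i =
     (if i \<ge> 0 then (next_minimum K ^^ nat i) 1
      else (inv_into (lattice_minima K) (next_minimum K) ^^ nat (- i)) 1)"

definition principal_ideal :: "real set \<Rightarrow> real \<Rightarrow> real set" where
  "principal_ideal K a = (\<lambda>x. a * x) ` ring_of_integers K"

definition nonunitary_principal_factor :: "real set \<Rightarrow> real \<Rightarrow> bool" where
  "nonunitary_principal_factor K \<alpha> \<longleftrightarrow>
     \<alpha> \<in> ring_of_integers K \<and> \<alpha> \<notin> int_units K \<and>
     \<alpha> ^ 3 / field_norm K \<alpha> \<in> int_units K \<and>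
     \<not> (\<exists>q\<in>\<rat>. principal_ideal K \<alpha> = principal_ideal K q)"

definition principal_factor_orbits :: "real set \<Rightarrow> real set set" where
  "principal_factor_orbits K =
     {(\<lambda>u. u * \<alpha>) ` pos_units K | \<alpha>. \<alpha> \<in> lattice_minima K \<and> nonunitary_principal_factor K \<alpha>}"

(* The type m of the two-sided chain of K is by definition a property of the whole set of
   lattice minima, which is the set of all members of the chain. *)
definition M_chain :: "nat \<Rightarrow> real set \<Rightarrow> (int \<Rightarrow> real) \<Rightarrow> bool" where
  "M_chain m K c \<longleftrightarrow>
     c = minima_chain K \<and> finite (principal_factor_orbits K) \<and> card (principal_factor_orbits K) = m"

end

theory Submission
  imports Defs
begin

text \<open>
  Write \<open>K = \<rat>(\<theta>)\<close>. Since \<open>\<theta>\<^sup>3 = b (1 - 3 r \<theta>)\<close> and \<open>1 - 3 r \<theta>\<close> is a unit, \<open>\<theta>\<close> and \<open>\<theta>\<^sup>2\<close> are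
  non-unitary differential principal factors of norm \<open>b\<close> and \<open>b\<^sup>2\<close>. The proof shows that every
  lattice minimum that is such a factor lies in the orbit of \<open>\<theta>\<close> or of \<open>\<theta>\<^sup>2\<close>, that
  \<open>\<theta>\<close> is a minimum, and that \<open>\<theta>\<^sup>2\<close> is one if the first bound on \<open>r\<close> holds.

  Upper bound. The positive units form an infinite cyclic group, because only finitely many of them
  lie in a bounded interval \<open>[1, C]\<close> (\<open>finite_bounded_units\<close>, \<open>pos_units_cyclic\<close>). So modulo
  cubes of positive units there are three classes. If an element of \<open>K\<close> has a rational cube, then
  it is rational (\<open>rational_cube_imp_rational\<close>): otherwise \<open>K\<close> is a pure cubic field, so that
  the discriminant \<open>-27 b\<^sup>2 (4 r\<^sup>3 b + 1)\<close> of the polynomial is \<open>-3\<close> times a square; but if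
  \<open>4 r\<^sup>3 b + 1\<close> is a square, then a cube root of an integer can be written down that lies in \<open>K\<close> and
  outside \<open>\<int>[\<theta>]\<close>, which contradicts monogenicity (\<open>discriminant_not_square\<close>). Hence
  \<open>e = 1 - 3 r \<theta>\<close> is not the cube of a unit \<open>u\<close>, since otherwise the cube root \<open>\<theta> / u\<close> of \<open>b\<close> would
  be rational, and \<open>\<theta>\<close> is not the product of a rational number and a unit; so \<open>1, e, e\<^sup>2\<close>
  represent the three classes. For a principal factor \<open>\<alpha>\<close> the unit
  \<open>\<alpha>\<^sup>3 / N(\<alpha>)\<close> is \<open>e\<^sup>k w\<^sup>3\<close> for some such \<open>k\<close>, so the
  cube of \<open>\<alpha> / (\<theta>\<^sup>k w)\<close> is rational and \<open>\<alpha> = q \<theta>\<^sup>k w\<close> with \<open>q\<close> rational. The case \<open>k = 0\<close> is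
  excluded by definition, integrality makes \<open>q\<close> an integer, and a lattice minimum is not divisible
  by an integer greater than one, so \<open>q = 1\<close> (\<open>principal_factor_minimum\<close>).

  Minima. Dividing by \<open>\<theta>\<^sup>k\<close> turns the question for \<open>\<theta>\<^sup>k\<close> into the question whether \<open>1\<close> is minimal in
  the lattice \<open>\<theta>\<^sup>-\<^sup>k \<int>[\<theta>]\<close>, which has the basis \<open>1, \<theta>, \<theta>\<^sup>2/b\<close> for \<open>k = 1\<close> and
  \<open>1, \<theta>/b, \<theta>\<^sup>2/b\<close> for \<open>k = 2\<close>. If \<open>\<mu>\<close> in this lattice and its conjugate \<open>\<mu>'\<close> have modulus less than
  one, then \<open>\<bar>Im \<mu>'\<bar> < 1\<close> forces the coefficient of the second basis vector not to have the opposite sign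
  of the third one, while \<open>\<bar>\<mu> - Re \<mu>'\<bar> < 2\<close> is violated as soon as the third one is not zero
  (\<open>one_minimal\<close>). This needs \<open>b\<^sup>2 \<le> 3 r b\<close> if \<open>k = 2\<close>, and that follows from the first bound on
  \<open>r\<close>; for \<open>k = 1\<close> it needs \<open>1 \<le> 3 r b\<close>.
\<close>

section \<open>Identities for a depressed cubic\<close>

text \<open>
  The relation \<open>t\<^sup>3 = q - p t\<close> reduces products of quadratic expressions in \<open>t\<close>. The same coordinates
  serve for the real root and for its complex conjugate; this makes the embedding multiplicative.
\<close>
lemma cubic_product:
  fixes t :: "'a :: idom"
  assumes "t ^ 3 + p * t - q = 0"
  shows "(x + y * t + z * t\<^sup>2) * (x' + y' * t + z' * t\<^sup>2) =
     (x * x' + q * (y * z' + z * y'))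
       + (x * y' + y * x' - p * (y * z' + z * y') + q * (z * z')) * t
       + (x * z' + y * y' + z * x' - p * (z * z')) * t\<^sup>2"
  using assms by algebra

text \<open>
  If \<open>T\<close> is a root as well, the last summand vanishes, and the quadratic factor is the
  one whose roots are the other two conjugates, with the square completed.
\<close>
lemma cubic_factor:
  fixes t T p q :: complex
  shows "t ^ 3 + p * t - q = (t - T) * ((t + T / 2)\<^sup>2 + 3 / 4 * T\<^sup>2 + p) + (T ^ 3 + p * T - q)"
  by (simp add: field_simps power2_eq_square power3_eq_cube)

lemma square_plus_square_factor:
  fixes t :: complex
  assumes "(t + T/2)\<^sup>2 + p = 0" "w\<^sup>2 = p"
  shows "(t + T / 2 - \<i> * w) * (t + T / 2 + \<i> * w) = 0"
proof -
  have "(t + T / 2 - \<i> * w) * (t + T / 2 + \<i> * w) = (t + T/2)\<^sup>2 + w\<^sup>2"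
    by (simp add: square_diff_square_factored[symmetric] power2_eq_square algebra_simps)
  thus ?thesis using assms by simp
qed

section \<open>The cubic field and its coordinates\<close>

locale cubic_root =
  fixes r b :: nat and \<theta> :: real
  assumes r_ge_1: "r \<ge> 1" and b_ge_2: "b \<ge> 2"
    and root: "\<theta> ^ 3 + 3 * real r * real b * \<theta> = real b"
begin

abbreviation K :: "real set" where "K \<equiv> rat_adjoin \<theta>"

definition elt :: "real \<Rightarrow> real \<Rightarrow> real \<Rightarrow> real" where
  "elt x y z = x + y * \<theta> + z * \<theta>\<^sup>2"

lemma root0: "\<theta> ^ 3 + 3 * real r * real b * \<theta> - real b = 0"
  using root by simp

lemma theta_pos: "\<theta> > 0" and theta_less: "3 * real r * \<theta> < 1"
proof -
  have "\<theta> * (\<theta>\<^sup>2 + 3 * real r * real b) > 0"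
    using root b_ge_2 by (simp add: power2_eq_square power3_eq_cube algebra_simps)
  moreover have "\<theta>\<^sup>2 + 3 * real r * real b \<ge> 0" by simp
  ultimately show pos: "\<theta> > 0" by (simp add: zero_less_mult_iff)
  have "\<theta>^3 > 0" using pos by simp
  moreover have "real b * (3 * real r * \<theta>) = 3 * real r * real b * \<theta>" by simp
  ultimately have "real b * (3 * real r * \<theta>) < real b * 1" using root by linarith
  thus "3 * real r * \<theta> < 1" using b_ge_2 by simp
qed

lemma theta_less_1: "\<theta> < 1"
proof -
  have "1 * \<theta> \<le> 3 * real r * \<theta>" using r_ge_1 theta_pos by (intro mult_right_mono) auto
  thus ?thesis using theta_less by simp
qed

text \<open>
  A rational root is an integer, because the cubic is monic, but every real root lies strictly
  between \<open>0\<close> and \<open>1\<close>.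
\<close>
lemma real_root_irrational:
  fixes c :: real
  assumes "c ^ 3 + 3 * real r * real b * c = real b"
  shows "c \<notin> \<rat>"
proof
  assume "c \<in> \<rat>"
  interpret c: cubic_root r b c
    by unfold_locales (use r_ge_1 b_ge_2 assms in auto)
  have "algebraic_int c"
    unfolding algebraic_int_altdef_ipoly
    by (intro exI[of _ "[:- int b, 3 * int r * int b, 0, 1:]"])
       (use assms in \<open>simp add: map_poly_pCons algebra_simps power3_eq_cube\<close>)
  with \<open>c \<in> \<rat>\<close> have "c \<in> \<int>" by (rule rational_algebraic_int_is_int[rotated])
  then obtain k :: int where "c = of_int k" by (auto elim: Ints_cases)
  thus False using c.theta_pos c.theta_less_1 by simp
qed

text \<open>
  Linear independence of \<open>1, \<theta>, \<theta>\<^sup>2\<close> over the rationals. If \<open>\<theta>\<^sup>2 = s \<theta> + t\<close>, then the cubic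
  splits as \<open>(X\<^sup>2 - s X - t) (X + s)\<close>, so \<open>-s\<close> is a rational root of it.
\<close>
lemma elt_eq_0_iff:
  assumes "x \<in> \<rat>" "y \<in> \<rat>" "z \<in> \<rat>"
  shows "elt x y z = 0 \<longleftrightarrow> x = 0 \<and> y = 0 \<and> z = 0"
proof
  assume *: "elt x y z = 0"
  have "z = 0"
  proof (rule ccontr)
    assume z: "z \<noteq> 0"
    define s t where "s = - y / z" and "t = - x / z"
    have st: "s \<in> \<rat>" "t \<in> \<rat>" using assms by (auto simp: s_def t_def)
    have sq: "\<theta>\<^sup>2 = s * \<theta> + t" using * z by (simp add: elt_def s_def t_def field_simps)
    have lin: "(s\<^sup>2 + t + 3 * real r * real b) * \<theta> + (s * t - real b) = 0"
      using root0 sq by algebra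
    have 1: "s\<^sup>2 + t + 3 * real r * real b = 0"
    proof (rule ccontr)
      assume n: "s\<^sup>2 + t + 3 * real r * real b \<noteq> 0"
      hence "\<theta> = (real b - s * t) / (s\<^sup>2 + t + 3 * real r * real b)"
        using lin by (simp add: field_simps)
      moreover have "\<dots> \<in> \<rat>" using st by (intro Rats_divide Rats_diff Rats_add Rats_mult Rats_power) auto
      ultimately show False using real_root_irrational[OF root] by simp
    qed
    with lin have "s * t = real b" by simp
    hence "s * t - real b = 0" by simp
    with 1 have "(-s) ^ 3 + 3 * real r * real b * (-s) - real b = 0" by algebra
    thus False using real_root_irrational[of "-s"] st by simp
  qed
  moreover have "y = 0"
  proof (rule ccontr)
    assume "y \<noteq> 0"
    hence "\<theta> = - x / y" using * \<open>z = 0\<close> by (simp add: elt_def field_simps)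
    thus False using real_root_irrational[OF root] assms by auto
  qed
  ultimately show "x = 0 \<and> y = 0 \<and> z = 0" using * by (simp add: elt_def)
qed (simp add: elt_def)

lemma elt_inject:
  assumes "x \<in> \<rat>" "y \<in> \<rat>" "z \<in> \<rat>" "x' \<in> \<rat>" "y' \<in> \<rat>" "z' \<in> \<rat>" "elt x y z = elt x' y' z'"
  shows "x = x' \<and> y = y' \<and> z = z'"
  using elt_eq_0_iff[of "x - x'" "y - y'" "z - z'"] assms by (simp add: elt_def algebra_simps)

lemma elt_mult:
  fixes x y z x' y' z' :: real
  shows
  "elt x y z * elt x' y' z' =
     elt (x * x' + real b * (y * z' + z * y'))
         (x * y' + y * x' - 3 * real r * real b * (y * z' + z * y') + real b * (z * z'))
         (x * z' + y * y' + z * x' - 3 * real r * real b * (z * z'))"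
  unfolding elt_def using root0 by algebra

text \<open>
  Real part of the conjugate of \<open>x + y \<theta> + z \<theta>\<^sup>2\<close>: the conjugates of \<open>\<theta>\<close> are \<open>-\<theta>/2 \<plusminus> i w\<close> with
  \<open>w = conj_im\<close>, and \<open>\<theta>\<^sup>2/4 - w\<^sup>2 = -(\<theta>\<^sup>2/2 + 3 r b)\<close>.
\<close>
definition conj_re :: "real \<Rightarrow> real \<Rightarrow> real \<Rightarrow> real" where
  "conj_re x y z = x - y * \<theta> / 2 - z * (\<theta>\<^sup>2 / 2 + 3 * real r * real b)"

definition conj_im :: real where
  "conj_im = sqrt (3 / 4 * \<theta>\<^sup>2 + 3 * real r * real b)"

text \<open>
  The norm of \<open>x + y \<theta> + z \<theta>\<^sup>2\<close>, expanded as a cubic form with integral coefficients.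
\<close>
definition norm_form :: "real \<Rightarrow> real \<Rightarrow> real \<Rightarrow> real" where
  "norm_form x y z = x^3 - 2 * (3 * real r * real b) * x\<^sup>2 * z + (3 * real r * real b) * x * y\<^sup>2
     + (3 * real r * real b)\<^sup>2 * x * z\<^sup>2 - 3 * real b * x * y * z + real b * y^3 + real b * (3 * real r * real b) * y * z\<^sup>2 + (real b)\<^sup>2 * z^3"

lemma conj_im_sq: "conj_im\<^sup>2 = 3 / 4 * \<theta>\<^sup>2 + 3 * real r * b"
  by (simp add: conj_im_def)

lemma conj_im_pos: "conj_im > 0"
  using theta_pos by (simp add: conj_im_def add_pos_nonneg)

definition cnorm :: "real \<Rightarrow> real \<Rightarrow> real \<Rightarrow> real" where
  "cnorm x y z = (conj_re x y z)\<^sup>2 + (conj_im * (y - z * \<theta>))\<^sup>2"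

text \<open>
  The product of the two complex conjugates of an element lies in the field again; so an
  element divides its norm, which provides inverses.
\<close>
lemma cnorm_eq_elt: "cnorm x y z = elt (x\<^sup>2 - 6 * real r * real b * x * z + (3 * real r * real b) * y\<^sup>2 + (3 * real r * real b)\<^sup>2 * z\<^sup>2 - real b * y * z)
   (real b * z\<^sup>2 - x * y) (y\<^sup>2 - x * z + 3 * real r * real b * z\<^sup>2)"
  unfolding elt_def cnorm_def conj_re_def power_mult_distrib conj_im_sq
  using root0 by algebra

lemma norm_form: "elt x y z * cnorm x y z = norm_form x y z"
  unfolding cnorm_eq_elt unfolding elt_def norm_form_def using root0 by algebra

lemma cnorm_eq_0_iff:
  assumes "x \<in> \<rat>" "y \<in> \<rat>" "z \<in> \<rat>"
  shows "cnorm x y z = 0 \<longleftrightarrow> x = 0 \<and> y = 0 \<and> z = 0"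
proof
  assume "cnorm x y z = 0"
  hence *: "conj_re x y z = 0" "y = z * \<theta>"
    using conj_im_pos by (auto simp: cnorm_def sum_power2_eq_zero_iff)
  hence "elt (- y) z 0 = 0" by (simp add: elt_def)
  hence "y = 0" "z = 0" using elt_eq_0_iff[of "-y" z 0] assms by auto
  thus "x = 0 \<and> y = 0 \<and> z = 0" using * by (simp add: conj_re_def)
qed (simp add: cnorm_def conj_re_def)

lemma inverse_elt_in:
  assumes "x \<in> \<rat>" "y \<in> \<rat>" "z \<in> \<rat>"
  shows "\<exists>x'\<in>\<rat>. \<exists>y'\<in>\<rat>. \<exists>z'\<in>\<rat>. inverse (elt x y z) = elt x' y' z'"
proof (cases "elt x y z = 0")
  case True
  thus ?thesis by (intro bexI[of _ 0]) (auto simp: elt_def)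
next
  case False
  hence "cnorm x y z \<noteq> 0" using cnorm_eq_0_iff[OF assms] by (auto simp: elt_def)
  hence N: "norm_form x y z \<noteq> 0" using False norm_form[of x y z] by auto
  define n where "n = norm_form x y z"
  have n: "n \<in> \<rat>" using assms by (auto simp: n_def norm_form_def)
  have "inverse (elt x y z) = cnorm x y z / n"
    using norm_form[of x y z] False N by (simp add: field_simps n_def)
  moreover obtain X Y Z where "cnorm x y z = elt X Y Z" "X \<in> \<rat>" "Y \<in> \<rat>" "Z \<in> \<rat>"
    using that[OF cnorm_eq_elt] assms by simp
  ultimately have "inverse (elt x y z) = elt (X / n) (Y / n) (Z / n)"
    by (simp add: elt_def add_divide_distrib)
  thus ?thesis using \<open>X \<in> \<rat>\<close> \<open>Y \<in> \<rat>\<close> \<open>Z \<in> \<rat>\<close> n by (metis Rats_divide)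
qed

lemma rat_adjoin_eq: "K = {elt x y z | x y z. x \<in> \<rat> \<and> y \<in> \<rat> \<and> z \<in> \<rat>}" (is "_ = ?A")
proof
  have A: "elt x y z \<in> ?A" if "x \<in> \<rat>" "y \<in> \<rat>" "z \<in> \<rat>" for x y z :: real
    using that by blast
  have "is_subfield ?A"
    unfolding is_subfield_def
  proof (intro conjI ballI)
    show "1 \<in> ?A" using A[of 1 0 0] by (simp add: elt_def)
  next
    fix u v assume "u \<in> ?A" "v \<in> ?A"
    then obtain x y z x' y' z' where *: "u = elt x y z" "v = elt x' y' z'"
      "x \<in> \<rat>" "y \<in> \<rat>" "z \<in> \<rat>" "x' \<in> \<rat>" "y' \<in> \<rat>" "z' \<in> \<rat>" by blast
    have diff: "u - v = elt (x - x') (y - y') (z - z')"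
      unfolding *(1,2) by (simp add: elt_def algebra_simps)
    show "u - v \<in> ?A" unfolding diff by (rule A) (simp_all add: *(3-))
    show "u * v \<in> ?A" unfolding *(1,2) elt_mult by (rule A) (simp_all add: *(3-))
  next
    fix u assume "u \<in> ?A"
    then obtain x y z where *: "u = elt x y z" "x \<in> \<rat>" "y \<in> \<rat>" "z \<in> \<rat>" by blast
    from inverse_elt_in[OF *(2-4)] obtain x' y' z' where
      inv: "inverse (elt x y z) = elt x' y' z'" and rat: "x' \<in> \<rat>" "y' \<in> \<rat>" "z' \<in> \<rat>"
      by blast
    show "inverse u \<in> ?A" unfolding *(1) inv by (rule A) (fact rat)+
  qed
  moreover have "\<theta> \<in> ?A" using A[of 0 1 0] by (simp add: elt_def)
  ultimately show "K \<subseteq> ?A" unfolding rat_adjoin_def by blast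
next
  show "?A \<subseteq> K" unfolding rat_adjoin_def
  proof safe
    fix x y z :: real and F assume *: "x \<in> \<rat>" "y \<in> \<rat>" "z \<in> \<rat>" "is_subfield F" "\<theta> \<in> F"
    from * have one: "1 \<in> F" and diff: "\<And>u v. u \<in> F \<Longrightarrow> v \<in> F \<Longrightarrow> u - v \<in> F"
      and mult: "\<And>u v. u \<in> F \<Longrightarrow> v \<in> F \<Longrightarrow> u * v \<in> F" and inv: "\<And>u. u \<in> F \<Longrightarrow> inverse u \<in> F"
      by (auto simp: is_subfield_def)
    have zero: "0 \<in> F" using diff[OF one one] by simp
    have neg: "- u \<in> F" if "u \<in> F" for u using diff[OF zero that] by simp
    have add: "u + v \<in> F" if "u \<in> F" "v \<in> F" for u v using diff[OF that(1) neg[OF that(2)]] by simp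
    have nat: "of_nat n \<in> F" for n by (induction n) (auto simp: zero add one)
    have int: "of_int n \<in> F" for n by (cases n) (auto simp: nat neg simp del: of_nat_Suc)
    have rat: "q \<in> F" if "q \<in> \<rat>" for q
      using that by (auto elim!: Rats_cases' simp: divide_inverse intro!: mult inv int)
    show "elt x y z \<in> F" unfolding elt_def power2_eq_square
      by (intro add mult rat[OF *(1)] rat[OF *(2)] rat[OF *(3)] *(5))
  qed
qed

lemma int_adjoin_eq: "int_adjoin \<theta> = {elt x y z | x y z. x \<in> \<int> \<and> y \<in> \<int> \<and> z \<in> \<int>}" (is "_ = ?A")
proof
  have "poly (map_poly of_int q) \<theta> \<in> ?A" for q :: "int poly"
  proof (induction q)
    case 0
    show ?case by (auto simp: elt_def intro!: exI[of _ 0])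
  next
    case (pCons a q)
    then obtain x y z where *: "poly (map_poly of_int q) \<theta> = elt x y z" "x \<in> \<int>" "y \<in> \<int>" "z \<in> \<int>"
      by blast
    have "poly (map_poly of_int (pCons a q)) \<theta> = of_int a + elt 0 1 0 * elt x y z"
      using * by (simp add: map_poly_pCons elt_def)
    also have "\<dots> = elt (of_int a + real b * z) (x - 3 * real r * real b * z) y"
      unfolding elt_mult by (simp add: elt_def algebra_simps)
    finally show ?case using *(2-) by (auto intro!: exI)
  qed
  thus "int_adjoin \<theta> \<subseteq> ?A" by (auto simp: int_adjoin_def)
next
  show "?A \<subseteq> int_adjoin \<theta>"
  proof safe
    fix x y z :: real assume "x \<in> \<int>" "y \<in> \<int>" "z \<in> \<int>"
    then obtain i j k where "x = of_int i" "y = of_int j" "z = of_int k" by (auto elim!: Ints_cases)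
    hence "elt x y z = poly (map_poly of_int [:i, j, k:]) \<theta>"
      by (simp add: map_poly_pCons elt_def algebra_simps power2_eq_square)
    thus "elt x y z \<in> int_adjoin \<theta>" unfolding int_adjoin_def by blast
  qed
qed

section \<open>The complex embedding\<close>

definition conj_theta :: complex where
  "conj_theta = Complex (- \<theta> / 2) conj_im"

lemma conj_theta_root: "conj_theta ^ 3 + 3 * of_nat r * of_nat b * conj_theta - of_nat b = 0"
proof -
  have "(conj_theta + of_real \<theta> / 2)\<^sup>2 = - of_real (conj_im\<^sup>2)"
    by (simp add: conj_theta_def complex_eq_iff power2_eq_square)
  hence "(conj_theta + of_real \<theta> / 2)\<^sup>2 + 3 / 4 * (of_real \<theta>)\<^sup>2 + 3 * of_nat r * of_nat b = 0"
    unfolding conj_im_sq by simp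
  moreover have "of_real \<theta> ^ 3 + 3 * of_nat r * of_nat b * of_real \<theta> - of_nat b = (0 :: complex)"
    using arg_cong[OF root0, of complex_of_real] by simp
  ultimately show ?thesis
    using cubic_factor[of conj_theta "3 * of_nat r * of_nat b" "of_nat b" "of_real \<theta>"] by simp
qed

definition conj_elt :: "real \<Rightarrow> real \<Rightarrow> real \<Rightarrow> complex" where
  "conj_elt x y z = Complex (conj_re x y z) (conj_im * (y - z * \<theta>))"

lemma conj_elt_eq:
  "conj_elt x y z = of_real x + of_real y * conj_theta + of_real z * conj_theta\<^sup>2"
  using conj_im_sq
  by (simp add: conj_elt_def conj_theta_def complex_eq_iff power2_eq_square conj_re_def algebra_simps)

lemma conj_elt_mult:
  "conj_elt x y z * conj_elt x' y' z' =
     conj_elt (x * x' + real b * (y * z' + z * y'))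
       (x * y' + y * x' - 3 * real r * real b * (y * z' + z * y') + real b * (z * z'))
       (x * z' + y * y' + z * x' - 3 * real r * real b * (z * z'))"
  unfolding conj_elt_eq cubic_product[OF conj_theta_root] by simp

lemma cnorm_eq_cmod: "cnorm x y z = (cmod (conj_elt x y z))\<^sup>2"
  by (simp add: conj_elt_def cmod_power2 cnorm_def)

text \<open>
  Linear independence makes the substitution of the complex root for \<open>\<theta>\<close> well defined.
\<close>
lemma ex_nonreal_embedding: "\<exists>\<sigma>. nonreal_embedding K \<sigma>"
proof -
  define \<sigma> where "\<sigma> u = (SOME c. \<exists>x\<in>\<rat>. \<exists>y\<in>\<rat>. \<exists>z\<in>\<rat>. u = elt x y z \<and> c = conj_elt x y z)" for u
  have \<sigma>: "\<sigma> (elt x y z) = conj_elt x y z" if "x \<in> \<rat>" "y \<in> \<rat>" "z \<in> \<rat>" for x y z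
    unfolding \<sigma>_def
  proof (rule some_equality)
    show "\<exists>x'\<in>\<rat>. \<exists>y'\<in>\<rat>. \<exists>z'\<in>\<rat>. elt x y z = elt x' y' z' \<and> conj_elt x y z = conj_elt x' y' z'"
      using that by blast
  next
    fix c assume "\<exists>x'\<in>\<rat>. \<exists>y'\<in>\<rat>. \<exists>z'\<in>\<rat>. elt x y z = elt x' y' z' \<and> c = conj_elt x' y' z'"
    thus "c = conj_elt x y z" using elt_inject that by blast
  qed
  have "nonreal_embedding K \<sigma>"
    unfolding nonreal_embedding_def
  proof (intro conjI ballI)
    have "\<sigma> (elt 1 0 0) = 1" by (subst \<sigma>) (auto simp: conj_elt_eq)
    thus "\<sigma> 1 = 1" by (simp add: elt_def)
  next
    fix u v assume "u \<in> K" "v \<in> K"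
    then obtain x y z x' y' z' where *: "u = elt x y z" "v = elt x' y' z'"
      "x \<in> \<rat>" "y \<in> \<rat>" "z \<in> \<rat>" "x' \<in> \<rat>" "y' \<in> \<rat>" "z' \<in> \<rat>" unfolding rat_adjoin_eq by blast
    have "u + v = elt (x + x') (y + y') (z + z')" using * by (simp add: elt_def algebra_simps)
    thus "\<sigma> (u + v) = \<sigma> u + \<sigma> v" using * by (simp add: \<sigma> conj_elt_eq algebra_simps)
    show "\<sigma> (u * v) = \<sigma> u * \<sigma> v"
      unfolding *(1,2) elt_mult using *(3-) by (simp add: \<sigma> conj_elt_mult)
  next
    have "\<sigma> (elt 0 1 0) = conj_theta" by (subst \<sigma>) (auto simp: conj_elt_eq)
    moreover have "conj_theta \<notin> \<real>" using conj_im_pos by (simp add: conj_theta_def complex_is_Real_iff)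
    moreover have "elt 0 1 0 \<in> K" unfolding rat_adjoin_eq using Rats_0 Rats_1 by blast
    ultimately show "\<exists>x\<in>K. \<sigma> x \<notin> \<real>" by metis
  qed
  thus ?thesis by blast
qed

text \<open>
  Such an embedding fixes the rationals and sends \<open>\<theta>\<close> to a non-real root of the cubic, hence to one
  of the two complex conjugates, which give the same absolute value. So the conjugate norm does not
  depend on the embedding that the choice operator picks.
\<close>
lemma nonreal_embedding_elt:
  assumes \<sigma>: "nonreal_embedding K \<sigma>" and rat: "x \<in> \<rat>" "y \<in> \<rat>" "z \<in> \<rat>"
  shows "(cmod (\<sigma> (elt x y z)))\<^sup>2 = cnorm x y z"
proof -
  have one: "\<sigma> 1 = 1" and add: "\<And>u v. u \<in> K \<Longrightarrow> v \<in> K \<Longrightarrow> \<sigma> (u + v) = \<sigma> u + \<sigma> v"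
    and mult: "\<And>u v. u \<in> K \<Longrightarrow> v \<in> K \<Longrightarrow> \<sigma> (u * v) = \<sigma> u * \<sigma> v"
    and nonreal: "\<exists>u\<in>K. \<sigma> u \<notin> \<real>"
    using \<sigma> by (auto simp: nonreal_embedding_def)
  have K: "elt x y z \<in> K" if "x \<in> \<rat>" "y \<in> \<rat>" "z \<in> \<rat>" for x y z
    using that unfolding rat_adjoin_eq by blast
  have Kq: "q \<in> K" if "q \<in> \<rat>" for q using K[of q 0 0] that by (simp add: elt_def)
  have K\<theta>: "\<theta> \<in> K" "\<theta>\<^sup>2 \<in> K" using K[of 0 1 0] K[of 0 0 1] by (simp_all add: elt_def)
  have zero: "\<sigma> 0 = 0" using add[of 0 0] Kq by simp
  have nat: "\<sigma> (of_nat n) = of_nat n" for n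
    by (induction n) (auto simp: zero one add Kq)
  have minus: "\<sigma> (- u) = - \<sigma> u" if "u \<in> K" for u
  proof -
    have "\<sigma> (-1) + 1 = 0" using add[of "-1" 1] Kq one zero by simp
    hence "\<sigma> (-1) = -1" by (simp add: add_eq_0_iff2)
    thus ?thesis using mult[of "-1" u] Kq that by simp
  qed
  have int: "\<sigma> (of_int n) = of_int n" for n
  proof (cases n)
    case (neg m)
    thus ?thesis using nat[of "Suc m"] minus[of "of_nat (Suc m)"] Kq[of "of_nat (Suc m)"] by simp
  qed (use nat in auto)
  have rat': "\<sigma> q = of_real q" if q: "q \<in> \<rat>" for q
  proof -
    obtain a c where ac: "q = of_int a / of_int c" "c > 0" using q by (elim Rats_cases') blast
    have qc: "q * of_int c = of_int a" using ac by simp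
    have "\<sigma> q * \<sigma> (of_int c) = \<sigma> (q * of_int c)"
      by (rule mult[symmetric]) (auto intro: Kq q)
    hence "\<sigma> q * of_int c = of_int a" unfolding qc int .
    hence "\<sigma> q = of_int a / of_int c" using ac(2) by (simp add: eq_divide_eq)
    thus ?thesis using ac by simp
  qed
  have expand: "\<sigma> (elt x y z) = of_real x + of_real y * \<sigma> \<theta> + of_real z * (\<sigma> \<theta>)\<^sup>2"
    if "x \<in> \<rat>" "y \<in> \<rat>" "z \<in> \<rat>" for x y z
  proof -
    have "elt x y 0 \<in> K" "y * \<theta> \<in> K" "z * \<theta>\<^sup>2 \<in> K" using K[of x y 0] K[of 0 y 0] K[of 0 0 z] that
      by (simp_all add: elt_def)
    moreover have "\<sigma> (\<theta>\<^sup>2) = (\<sigma> \<theta>)\<^sup>2" using mult[of \<theta> \<theta>] K\<theta> by (simp add: power2_eq_square)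
    ultimately show ?thesis using that by (simp add: elt_def add mult Kq K\<theta> rat')
  qed
  define t where "t = \<sigma> \<theta>"
  have "t \<notin> \<real>"
  proof
    assume "t \<in> \<real>"
    obtain u where "u \<in> K" "\<sigma> u \<notin> \<real>" using nonreal by blast
    moreover then obtain x y z where "u = elt x y z" "x \<in> \<rat>" "y \<in> \<rat>" "z \<in> \<rat>"
      unfolding rat_adjoin_eq by blast
    ultimately show False using expand[of x y z] \<open>t \<in> \<real>\<close> by (auto simp: t_def)
  qed
  hence "t - of_real \<theta> \<noteq> 0" by auto
  have "elt 0 1 0 * elt 0 0 1 = elt (real b) (- 3 * real r * real b) 0" by (simp add: elt_mult)
  hence "\<sigma> (elt 0 1 0) * \<sigma> (elt 0 0 1) = \<sigma> (elt (real b) (- 3 * real r * real b) 0)"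
    using mult[of "elt 0 1 0" "elt 0 0 1"] K by simp
  hence "t ^ 3 + 3 * of_nat r * of_nat b * t - of_nat b = 0"
    by (simp add: expand t_def power2_eq_square power3_eq_cube mult.assoc)
  moreover have "of_real \<theta> ^ 3 + 3 * of_nat r * of_nat b * of_real \<theta> - of_nat b = (0 :: complex)"
    using arg_cong[OF root0, of complex_of_real] by simp
  ultimately have "(t - of_real \<theta>) * ((t + of_real \<theta> / 2)\<^sup>2 + 3 / 4 * (of_real \<theta>)\<^sup>2 + 3 * of_nat r * of_nat b) = 0"
    using cubic_factor[of t "3 * of_nat r * of_nat b" "of_nat b" "of_real \<theta>"] by simp
  hence "(t + of_real \<theta> / 2)\<^sup>2 + (3 / 4 * (of_real \<theta>)\<^sup>2 + 3 * of_nat r * of_nat b) = 0"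
    unfolding add.assoc[symmetric] using \<open>t - of_real \<theta> \<noteq> 0\<close> by simp
  moreover have "(complex_of_real conj_im)\<^sup>2 = 3 / 4 * (of_real \<theta>)\<^sup>2 + 3 * of_nat r * of_nat b"
    using arg_cong[OF conj_im_sq, of complex_of_real] by simp
  ultimately have "(t + of_real \<theta> / 2 - \<i> * of_real conj_im) * (t + of_real \<theta> / 2 + \<i> * of_real conj_im) = 0"
    using square_plus_square_factor by blast
  hence "t + of_real \<theta> / 2 - \<i> * of_real conj_im = 0 \<or> t + of_real \<theta> / 2 + \<i> * of_real conj_im = 0"
    by (simp only: mult_eq_0_iff)
  hence "t = conj_theta \<or> t = cnj conj_theta"
    by (simp add: conj_theta_def complex_eq_iff add_eq_0_iff2 eq_diff_eq')
  moreover have "cmod (of_real x + of_real y * cnj conj_theta + of_real z * (cnj conj_theta)\<^sup>2) =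
    cmod (of_real x + of_real y * conj_theta + of_real z * (conj_theta)\<^sup>2)"
    by (subst complex_mod_cnj[symmetric]) (simp del: complex_mod_cnj)
  ultimately have "cmod (\<sigma> (elt x y z)) = cmod (conj_elt x y z)"
    using expand[OF rat] by (auto simp: t_def conj_elt_eq)
  thus ?thesis by (simp add: cnorm_eq_cmod)
qed

lemma conj_norm_elt:
  assumes "x \<in> \<rat>" "y \<in> \<rat>" "z \<in> \<rat>"
  shows "conj_norm K (elt x y z) = cnorm x y z"
  unfolding conj_norm_def conjugate_def
  using someI_ex[OF ex_nonreal_embedding] assms by (rule nonreal_embedding_elt)

lemma conj_norm_mult:
  assumes "u \<in> K" "v \<in> K"
  shows "conj_norm K (u * v) = conj_norm K u * conj_norm K v"
  using someI_ex[OF ex_nonreal_embedding] assms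
  by (simp add: conj_norm_def conjugate_def nonreal_embedding_def norm_mult power_mult_distrib)

section \<open>The conjugate norm on the field\<close>

lemma elt_in_K: "x \<in> \<rat> \<Longrightarrow> y \<in> \<rat> \<Longrightarrow> z \<in> \<rat> \<Longrightarrow> elt x y z \<in> K"
  unfolding rat_adjoin_eq by blast

lemma field_norm_elt:
  assumes "x \<in> \<rat>" "y \<in> \<rat>" "z \<in> \<rat>"
  shows "field_norm K (elt x y z) = norm_form x y z"
  using conj_norm_elt[OF assms] norm_form by (simp add: field_norm_def)

lemma rat_in_K: "q \<in> \<rat> \<Longrightarrow> q \<in> K"
  using elt_in_K[of q 0 0] by (simp add: elt_def)

lemma conj_norm_rat: "q \<in> \<rat> \<Longrightarrow> conj_norm K q = q\<^sup>2"
  using conj_norm_elt[of q 0 0] by (simp add: elt_def cnorm_def conj_re_def)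

lemma conj_norm_pos:
  assumes "u \<in> K" "u \<noteq> 0"
  shows "conj_norm K u > 0"
proof -
  obtain x y z where "u = elt x y z" "x \<in> \<rat>" "y \<in> \<rat>" "z \<in> \<rat>"
    using assms(1) unfolding rat_adjoin_eq by blast
  moreover have "cnorm x y z \<ge> 0" by (simp add: cnorm_def)
  ultimately show ?thesis using conj_norm_elt cnorm_eq_0_iff[of x y z] assms(2)
    by (auto simp: elt_def less_le)
qed

lemma theta_eq_elt: "\<theta> = elt 0 1 0"
  by (simp add: elt_def)

lemma theta_cube: "\<theta> ^ 3 = real b * (1 - 3 * real r * \<theta>)"
  using root by (simp add: algebra_simps)

lemma conj_norm_theta: "conj_norm K \<theta> = real b / \<theta>"
proof -
  have "\<theta> * conj_norm K \<theta> = real b"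
    using norm_form[of 0 1 0] conj_norm_elt[of 0 1 0] by (simp add: theta_eq_elt[symmetric] norm_form_def)
  thus ?thesis using theta_pos by (simp add: field_simps)
qed

lemma theta_pow_in_K: "\<theta> ^ k \<in> K"
proof (induction k)
  case 0
  show ?case using elt_in_K[of 1 0 0] by (simp add: elt_def)
next
  case (Suc k)
  then obtain x y z where *: "\<theta> ^ k = elt x y z" "x \<in> \<rat>" "y \<in> \<rat>" "z \<in> \<rat>"
    unfolding rat_adjoin_eq by blast
  have "\<theta> ^ Suc k = elt 0 1 0 * elt x y z" using * by (simp add: elt_def)
  also have "\<dots> \<in> K" unfolding elt_mult using *(2-) by (intro elt_in_K) simp_all
  finally show ?case .
qed

lemma conj_norm_theta_pow: "conj_norm K (\<theta> ^ k) = (real b / \<theta>) ^ k"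
proof (induction k)
  case 0
  show ?case using conj_norm_rat[of 1] by simp
next
  case (Suc k)
  thus ?case using conj_norm_mult[of \<theta> "\<theta>^k"] theta_pow_in_K[of k] theta_pow_in_K[of 1]
    by (simp add: conj_norm_theta)
qed

lemma K_mult:
  assumes "u \<in> K" "v \<in> K"
  shows "u * v \<in> K"
proof -
  obtain x y z x' y' z' where *: "u = elt x y z" "v = elt x' y' z'"
    "x \<in> \<rat>" "y \<in> \<rat>" "z \<in> \<rat>" "x' \<in> \<rat>" "y' \<in> \<rat>" "z' \<in> \<rat>"
    using assms unfolding rat_adjoin_eq by blast
  show ?thesis unfolding *(1,2) elt_mult by (rule elt_in_K) (simp_all add: *(3-))
qed

text \<open>
  In \<open>\<mu> - Re \<mu>'\<close> the constant term cancels; the coefficient of \<open>z\<close> that remains is large.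
\<close>
lemma elt_diff_conj_re:
  "elt x y z - conj_re x y z = 3 / 2 * y * \<theta> + z * (3 / 2 * \<theta>\<^sup>2 + 3 * real r * real b)"
  by (simp add: elt_def conj_re_def algebra_simps)

lemma cnorm_le_1:
  assumes "cnorm x y z \<le> 1"
  shows "\<bar>conj_re x y z\<bar> \<le> 1" "\<bar>y - z * \<theta>\<bar> \<le> 1 / conj_im"
proof -
  have "(conj_re x y z)\<^sup>2 \<le> 1" "(conj_im * (y - z * \<theta>))\<^sup>2 \<le> 1"
    using assms zero_le_power2[of "conj_re x y z"] zero_le_power2[of "conj_im * (y - z * \<theta>)"]
    unfolding cnorm_def by linarith+
  hence *: "\<bar>conj_re x y z\<bar> \<le> 1" "\<bar>conj_im * (y - z * \<theta>)\<bar> \<le> 1"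
    by (auto simp: abs_square_le_1)
  show "\<bar>conj_re x y z\<bar> \<le> 1" by (fact *(1))
  show "\<bar>y - z * \<theta>\<bar> \<le> 1 / conj_im"
    using *(2) conj_im_pos by (simp add: abs_mult pos_le_divide_eq mult.commute)
qed

section \<open>Minimality of one in the scaled lattices\<close>

lemma rb_ge: "real r * real b \<ge> 2"
  using r_ge_1 b_ge_2 mult_mono[of 1 "real r" 2 "real b"] by simp

lemma conj_im_gt: 
  assumes "c\<^sup>2 \<le> 3 * real r * real b" 
  shows "conj_im > c"
proof (rule power2_less_imp_less)
  have "\<theta>\<^sup>2 > 0" using theta_pos by simp
  thus "c\<^sup>2 < conj_im\<^sup>2" using assms unfolding conj_im_sq by linarith
  show "conj_im \<ge> 0" using conj_im_pos by simp
qed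

text \<open>
  The imaginary part of the conjugate bounds \<open>Y / c - Z \<theta> / b\<close> by less than \<open>1 / c\<close>, so
  \<open>Y > -1\<close>, and an integer \<open>Y\<close> is not negative. Then \<open>\<mu> - Re \<mu>'\<close> is at least \<open>3 r Z \<ge> 3\<close>, although
  both terms have modulus at most \<open>1\<close>.
\<close>
lemma one_minimal_pos:
  fixes Y :: real
  assumes c: "0 < c" "c\<^sup>2 \<le> 3 * real r * real b" and "Y \<in> \<int>" "Z \<ge> 1"
    and lt: "\<bar>elt X (Y / c) (Z / real b)\<bar> < 1" "cnorm X (Y / c) (Z / real b) < 1"
  shows False
proof -
  have le: "\<bar>Y / c - Z / real b * \<theta>\<bar> \<le> 1 / conj_im" "\<bar>conj_re X (Y / c) (Z / real b)\<bar> \<le> 1"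
    using cnorm_le_1[OF less_imp_le[OF lt(2)]] by blast+
  hence "Y / c \<ge> Z / real b * \<theta> - 1 / conj_im" by linarith
  moreover have "Z / real b * \<theta> > 0" using assms theta_pos b_ge_2 by simp
  moreover have "1 / conj_im < 1 / c" using conj_im_gt[OF c(2)] c by (simp add: field_simps)
  ultimately have "Y / c > - 1 / c" by simp
  hence "Y > -1" using c by (simp add: field_simps)
  moreover obtain k :: int where "Y = of_int k" using \<open>Y \<in> \<int>\<close> by (auto elim: Ints_cases)
  ultimately have "Y \<ge> 0" by simp
  \<comment> \<open>The factor \<open>Z / b\<close> meets the summand \<open>3 r b\<close>, so that \<open>b\<close> cancels.\<close>
  have "3 * 1 * 1 \<le> 3 * real r * Z" using r_ge_1 \<open>Z \<ge> 1\<close> by (intro mult_mono) auto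
  also have "\<dots> = Z / real b * (3 * real r * real b)" using b_ge_2 by simp
  also have "\<dots> \<le> Z / real b * (3 / 2 * \<theta>\<^sup>2 + 3 * real r * real b)"
    using \<open>Z \<ge> 1\<close> by (intro mult_left_mono) auto
  also have "\<dots> \<le> 3 / 2 * (Y / c) * \<theta> + Z / real b * (3 / 2 * \<theta>\<^sup>2 + 3 * real r * real b)"
    using \<open>Y \<ge> 0\<close> c theta_pos by simp
  also have "\<dots> = elt X (Y / c) (Z / real b) - conj_re X (Y / c) (Z / real b)"
    by (simp only: elt_diff_conj_re)
  finally show False using lt(1) le(2) by linarith
qed

text \<open>
  By symmetry \<open>Z = 0\<close>; then the imaginary part kills \<open>Y\<close> and the real size kills \<open>X\<close>.
\<close>
lemma one_minimal:
  fixes X Y Z :: real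
  assumes c: "0 < c" "c\<^sup>2 \<le> 3 * real r * real b" and int: "X \<in> \<int>" "Y \<in> \<int>" "Z \<in> \<int>"
    and lt: "\<bar>elt X (Y / c) (Z / real b)\<bar> < 1" "cnorm X (Y / c) (Z / real b) < 1"
  shows "X = 0 \<and> Y = 0 \<and> Z = 0"
proof -
  have "\<not> Z \<ge> 1" using one_minimal_pos[OF c int(2) _ lt] by blast
  moreover have "\<not> - Z \<ge> 1"
  proof
    assume Z: "- Z \<ge> 1"
    have "elt (-X) (-Y / c) (-Z / real b) = - elt X (Y / c) (Z / real b)"
      by (simp add: elt_def)
    moreover have "cnorm (-X) (-Y / c) (-Z / real b) = cnorm X (Y / c) (Z / real b)"
      by (simp add: cnorm_eq_elt)
    ultimately show False using one_minimal_pos[OF c, of "-Y" "-Z" "-X"] Z int lt by simp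
  qed
  ultimately have "Z = 0" using int(3) by (auto elim!: Ints_cases)
  have "\<bar>Y / c\<bar> \<le> 1 / conj_im" using cnorm_le_1(2)[of X "Y / c" "Z / real b"] lt \<open>Z = 0\<close> by simp
  also have "1 / conj_im < 1 / c" using conj_im_gt[OF c(2)] c by (simp add: field_simps)
  finally have "\<bar>Y\<bar> < 1" using c by (simp add: field_simps)
  hence "Y = 0" using int(2) by (auto elim!: Ints_cases)
  moreover have "X = 0" using lt(1) int(1) \<open>Y = 0\<close> \<open>Z = 0\<close> by (auto elim!: Ints_cases simp: elt_def)
  ultimately show ?thesis using \<open>Z = 0\<close> by simp
qed

section \<open>Elements with a rational cube\<close>

text \<open>
  The embedding fixes rational numbers; here this is read off from coordinates.
\<close>
lemma conj_elt_cube: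
  assumes "x \<in> \<rat>" "y \<in> \<rat>" "z \<in> \<rat>" "elt x y z ^ 3 = q" "q \<in> \<rat>"
  shows "conj_elt x y z ^ 3 = of_real q"
proof -
  obtain X Y Z where 1: "elt x y z * elt x y z = elt X Y Z" "conj_elt x y z * conj_elt x y z = conj_elt X Y Z"
      "X \<in> \<rat>" "Y \<in> \<rat>" "Z \<in> \<rat>"
    using that[OF elt_mult conj_elt_mult] assms(1-3) by simp
  obtain U V W where 2: "elt X Y Z * elt x y z = elt U V W" "conj_elt X Y Z * conj_elt x y z = conj_elt U V W"
      "U \<in> \<rat>" "V \<in> \<rat>" "W \<in> \<rat>"
    using that[OF elt_mult conj_elt_mult] assms(1-3) 1(3-5) by simp
  have "elt U V W = elt q 0 0" using 1 2 assms(4) by (simp add: elt_def power3_eq_cube)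
  hence "U = q" "V = 0" "W = 0" using elt_inject[OF 2(3-5) assms(5) Rats_0 Rats_0] by blast+
  thus ?thesis using 1 2 by (simp add: power3_eq_cube conj_elt_eq)
qed

text \<open>
  If \<open>\<alpha>\<^sup>3\<close> is rational and \<open>\<alpha>\<close> is not, the conjugates of \<open>\<alpha>\<close> are its products with the third roots of
  unity. Hence the traces of \<open>\<alpha>\<close> and of \<open>\<alpha>\<^sup>2\<close> vanish. The first condition determines \<open>x\<close>, the second
  becomes the quadratic equation \<open>r y\<^sup>2 - y z - r\<^sup>2 b z\<^sup>2 = 0\<close>, whose discriminant \<open>(4 r\<^sup>3 b + 1) z\<^sup>2\<close> has
  to be a rational square.
\<close>
lemma rational_cube_imp_square:
  assumes xyz: "x \<in> \<rat>" "y \<in> \<rat>" "z \<in> \<rat>" and cube: "elt x y z ^ 3 \<in> \<rat>" and irrat: "elt x y z \<notin> \<rat>"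
  shows "\<exists>m\<in>\<rat>. m\<^sup>2 = 4 * real r ^ 3 * real b + 1"
proof -
  define \<alpha> A B where "\<alpha> = elt x y z" and "A = conj_re x y z" and "B = conj_im * (y - z * \<theta>)"
  have "Complex A B ^ 3 = of_real (\<alpha> ^ 3)"
    using conj_elt_cube[OF xyz refl cube] by (simp add: \<alpha>_def A_def B_def conj_elt_def)
  hence re: "A ^ 3 - 3 * A * B\<^sup>2 = \<alpha> ^ 3" and im: "B * (3 * A\<^sup>2 - B\<^sup>2) = 0"
    by (auto simp: complex_eq_iff power3_eq_cube power2_eq_square algebra_simps)
  have "B \<noteq> 0"
  proof
    assume "B = 0"
    hence "elt (- y) z 0 = 0" using conj_im_pos by (simp add: B_def elt_def)
    hence "y = 0" "z = 0" using elt_eq_0_iff[of "-y" z 0] xyz by auto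
    thus False using irrat xyz by (simp add: elt_def)
  qed
  hence B: "B\<^sup>2 = 3 * A\<^sup>2" using im by simp
  \<comment> \<open>The real part is half of minus \<open>\<alpha>\<close>: the trace of \<open>\<alpha>\<close> vanishes.\<close>
  have "\<alpha> ^ 3 = (- 2 * A) ^ 3"
    unfolding re[symmetric] B by (simp add: power3_eq_cube power2_eq_square)
  moreover have "odd (3 :: nat)" by simp
  ultimately have A: "\<alpha> = - 2 * A" by (metis odd_real_root_power_cancel)
  have tr: "x = 2 * real r * real b * z"
    using A by (simp add: \<alpha>_def A_def elt_def conj_re_def field_simps)
  have "(3 / 4 * \<theta>\<^sup>2 + 3 * real r * real b) * (y - z * \<theta>)\<^sup>2 = 3 / 4 * \<alpha>\<^sup>2"
    using B A by (simp add: B_def power_mult_distrib conj_im_sq)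
  hence eq: "(\<theta>\<^sup>2 + 4 * real r * real b) * (y - z * \<theta>)\<^sup>2 - (2 * real r * real b * z + y * \<theta> + z * \<theta>\<^sup>2)\<^sup>2 = 0"
    by (simp add: \<alpha>_def elt_def tr field_simps)
  have "(4 * real b) * (real r * y\<^sup>2 - y * z - real r ^ 2 * real b * z\<^sup>2) =
      (\<theta>\<^sup>2 + 4 * real r * real b) * (y - z * \<theta>)\<^sup>2 - (2 * real r * real b * z + y * \<theta> + z * \<theta>\<^sup>2)\<^sup>2
      + 4 * y * z * (\<theta> ^ 3 + 3 * real r * real b * \<theta> - real b)"
    by (simp add: algebra_simps power2_eq_square power3_eq_cube)
  hence "(4 * real b) * (real r * y\<^sup>2 - y * z - real r ^ 2 * real b * z\<^sup>2) = 0"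
    unfolding eq root0 by simp
  hence quad: "real r * y\<^sup>2 - y * z - real r ^ 2 * real b * z\<^sup>2 = 0" using b_ge_2 by simp
  have "z \<noteq> 0"
  proof
    assume "z = 0"
    thus False using quad r_ge_1 \<open>B \<noteq> 0\<close> by (simp add: B_def)
  qed
  define s where "s = y / z"
  have "y = s * z" using \<open>z \<noteq> 0\<close> by (simp add: s_def)
  hence "z\<^sup>2 * (real r * s\<^sup>2 - s - real r ^ 2 * real b) = 0"
    using quad by (simp add: algebra_simps power2_eq_square)
  hence "real r * s\<^sup>2 - s - real r ^ 2 * real b = 0" using \<open>z \<noteq> 0\<close> by simp
  hence "(2 * real r * s - 1)\<^sup>2 = 4 * real r ^ 3 * real b + 1" by algebra
  moreover have "2 * real r * s - 1 \<in> \<rat>" using xyz by (simp add: s_def)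
  ultimately show ?thesis by blast
qed

end

section \<open>Integers and units\<close>

locale monogenic_cubic_root = cubic_root +
  assumes integers: "int_adjoin \<theta> = ring_of_integers K"
begin

abbreviation OK :: "real set" where "OK \<equiv> ring_of_integers K"

lemma OK_eq: "OK = {elt x y z | x y z. x \<in> \<int> \<and> y \<in> \<int> \<and> z \<in> \<int>}"
  using integers int_adjoin_eq by simp

lemma elt_in_OK_iff:
  assumes "x \<in> \<rat>" "y \<in> \<rat>" "z \<in> \<rat>"
  shows "elt x y z \<in> OK \<longleftrightarrow> x \<in> \<int> \<and> y \<in> \<int> \<and> z \<in> \<int>"
proof
  assume "elt x y z \<in> OK"
  then obtain x' y' z' where "elt x y z = elt x' y' z'" "x' \<in> \<int>" "y' \<in> \<int>" "z' \<in> \<int>"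
    unfolding OK_eq by blast
  thus "x \<in> \<int> \<and> y \<in> \<int> \<and> z \<in> \<int>" using elt_inject assms by (metis Ints_subset_Rats subsetD)
qed (auto simp: OK_eq)

lemma OK_cases:
  assumes "u \<in> OK"
  obtains x y z where "u = elt x y z" "x \<in> \<int>" "y \<in> \<int>" "z \<in> \<int>" "x \<in> \<rat>" "y \<in> \<rat>" "z \<in> \<rat>"
  using assms unfolding OK_eq by (blast dest: Ints_subset_Rats[THEN subsetD])

lemma OK_subset: "u \<in> OK \<Longrightarrow> u \<in> K"
  by (simp add: ring_of_integers_def)

lemma OK_mult: 
  assumes "u \<in> OK" "v \<in> OK"
  shows "u * v \<in> OK"
proof -
  from assms(1) obtain x y z where 1: "u = elt x y z" "x \<in> \<int>" "y \<in> \<int>" "z \<in> \<int>" "x \<in> \<rat>" "y \<in> \<rat>" "z \<in> \<rat>"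
    by (rule OK_cases)
  from assms(2) obtain x' y' z' where 2: "v = elt x' y' z'" "x' \<in> \<int>" "y' \<in> \<int>" "z' \<in> \<int>" "x' \<in> \<rat>" "y' \<in> \<rat>" "z' \<in> \<rat>"
    by (rule OK_cases)
  show ?thesis unfolding 1(1) 2(1) elt_mult using 1(2-) 2(2-) by (subst elt_in_OK_iff) simp_all
qed

lemma int_in_OK: "x \<in> \<int> \<Longrightarrow> x \<in> OK"
  by (simp add: ring_of_integers_def int_imp_algebraic_int rat_in_K Ints_subset_Rats[THEN subsetD])

lemma theta_in_OK: "\<theta> \<in> OK"
  using elt_in_OK_iff[of 0 1 0] by (simp add: elt_def)

lemma OK_power: "u \<in> OK \<Longrightarrow> u ^ n \<in> OK"
  by (induction n) (auto intro: OK_mult int_in_OK)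

lemma field_norm_int: "u \<in> OK \<Longrightarrow> field_norm K u \<in> \<int>"
  by (elim OK_cases) (auto simp: field_norm_elt norm_form_def)

lemma int_units_mult: "u \<in> int_units K \<Longrightarrow> v \<in> int_units K \<Longrightarrow> u * v \<in> int_units K"
  by (auto simp: int_units_def OK_mult)

lemma pos_units_mult: "u \<in> pos_units K \<Longrightarrow> v \<in> pos_units K \<Longrightarrow> u * v \<in> pos_units K"
  by (auto simp: pos_units_def int_units_mult)

lemma pos_units_inverse: "u \<in> pos_units K \<Longrightarrow> inverse u \<in> pos_units K"
  by (auto simp: pos_units_def int_units_def)

lemma one_in_pos_units: "1 \<in> pos_units K"
  by (auto simp: pos_units_def int_units_def int_in_OK)

lemma pos_units_power: "u \<in> pos_units K \<Longrightarrow> u ^ n \<in> pos_units K"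
  by (induction n) (auto intro: pos_units_mult one_in_pos_units)

lemma pos_units_powi: "u \<in> pos_units K \<Longrightarrow> u powi n \<in> pos_units K"
  by (auto simp: power_int_def intro: pos_units_power pos_units_inverse)

text \<open>
  The norms of a unit and of its inverse are integers with product one, and the norm has the sign of
  the element.
\<close>
lemma pos_unit_norm:
  assumes "u \<in> pos_units K"
  shows "field_norm K u = 1"
proof -
  have u: "u > 0" "u \<in> OK" "inverse u \<in> OK" using assms by (auto simp: pos_units_def int_units_def)
  then obtain n m :: int where nm: "field_norm K u = of_int n" "field_norm K (inverse u) = of_int m"
    using field_norm_int by (metis Ints_cases)
  have "conj_norm K u * conj_norm K (inverse u) = 1"
    using conj_norm_mult[of u "inverse u"] u OK_subset conj_norm_rat[of 1] by simp
  hence "field_norm K u * field_norm K (inverse u) = 1"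
    using u(1) by (simp add: field_norm_def field_simps)
  hence "n * m = 1" using nm by (metis of_int_eq_1_iff of_int_mult)
  moreover have "field_norm K u > 0" using u conj_norm_pos[of u] OK_subset by (simp add: field_norm_def)
  hence "n > 0" using nm by simp
  ultimately show ?thesis using nm by (simp add: pos_zmult_eq_1_iff)
qed

text \<open>
  A unit \<open>u \<ge> 1\<close> has conjugates of absolute value at most one. As in the study of minimality, the
  imaginary part bounds \<open>y - z \<theta>\<close> and the difference of the real parts bounds \<open>z\<close>.
\<close>
lemma finite_bounded_units: "finite {u \<in> pos_units K. 1 \<le> u \<and> u \<le> C}"
proof (rule finite_subset)
  let ?I = "{k \<in> \<int>. \<bar>k :: real\<bar> \<le> 3 * C + 10}"
  show "finite ((\<lambda>(x, y, z). elt x y z) ` (?I \<times> ?I \<times> ?I))"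
    by (intro finite_imageI finite_cartesian_product finite_abs_int_segment)
  show "{u \<in> pos_units K. 1 \<le> u \<and> u \<le> C} \<subseteq> (\<lambda>(x, y, z). elt x y z) ` (?I \<times> ?I \<times> ?I)"
  proof clarify
    fix u assume u: "u \<in> pos_units K" "1 \<le> u" "u \<le> C"
    hence "u \<in> OK" by (simp add: pos_units_def int_units_def)
    then obtain x y z where xyz: "u = elt x y z" "x \<in> \<int>" "y \<in> \<int>" "z \<in> \<int>" "x \<in> \<rat>" "y \<in> \<rat>" "z \<in> \<rat>"
      by (rule OK_cases)
    have "u * cnorm x y z = 1"
      using pos_unit_norm[OF u(1)] xyz by (simp add: field_norm_def conj_norm_elt)
    hence "cnorm x y z = 1 / u" using u(2) by (simp add: field_simps)
    hence "cnorm x y z \<le> 1" using u(2) by simp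
    note c = cnorm_le_1[OF this]
    have "1 / conj_im \<le> 1" using conj_im_gt[of 1] rb_ge by (simp add: field_simps)
    hence y: "\<bar>y - z * \<theta>\<bar> \<le> 1" using c(2) by simp
    have y': "\<bar>(y - z * \<theta>) * \<theta>\<bar> \<le> 1"
      using mult_mono[OF y, of "\<bar>\<theta>\<bar>" 1] theta_pos theta_less_1 by (simp add: abs_mult)
    have zt: "\<bar>z * \<theta>\<bar> \<le> \<bar>z\<bar>" "\<bar>z * \<theta>\<^sup>2\<bar> \<le> \<bar>z\<bar>"  "\<bar>y * \<theta>\<bar> \<le> \<bar>y\<bar>"
      using theta_pos theta_less_1 by (auto simp: abs_mult mult_left_le power_le_one)
    have "\<bar>z\<bar> * 1 \<le> \<bar>z\<bar> * (3 * \<theta>\<^sup>2 + 3 * real r * real b)"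
      using rb_ge zero_le_power2[of \<theta>] by (intro mult_left_mono) linarith+
    also have "\<dots> = \<bar>z * (3 * \<theta>\<^sup>2 + 3 * real r * real b)\<bar>" by (simp add: abs_mult)
    also have "z * (3 * \<theta>\<^sup>2 + 3 * real r * real b) = u - conj_re x y z - 3 / 2 * ((y - z * \<theta>) * \<theta>)"
      using elt_diff_conj_re[of x y z] by (simp add: xyz(1) algebra_simps power2_eq_square)
    also have "\<bar>\<dots>\<bar> \<le> C + 1 + 3 / 2" using c(1) y' u by linarith
    finally have z: "\<bar>z\<bar> \<le> C + 5 / 2" by simp
    have y2: "\<bar>y\<bar> \<le> C + 7 / 2" using z zt y by linarith
    have "x = u - y * \<theta> - z * \<theta>\<^sup>2" by (simp add: xyz(1) elt_def)
    hence "\<bar>x\<bar> \<le> 3 * C + 10" using y2 z zt u by linarith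
    moreover have "\<bar>y\<bar> \<le> 3 * C + 10" "\<bar>z\<bar> \<le> 3 * C + 10" using y2 z u by linarith+
    ultimately show "u \<in> (\<lambda>(x, y, z). elt x y z) ` (?I \<times> ?I \<times> ?I)"
      using xyz by (intro image_eqI[of _ _ "(x, y, z)"]) auto
  qed
qed

lemma theta_cube_unit: "1 - 3 * real r * \<theta> \<in> pos_units K"
proof -
  let ?t = "3 * real r"
  \<comment> \<open>The second factor is \<open>b / \<theta>\<^sup>3\<close>, expanded with \<open>1 / \<theta> = (\<theta>\<^sup>2 + 3 r b) / b\<close>.\<close>
  have "(1 - ?t * \<theta>) * elt (1 + ?t ^ 3 * real b) ?t (?t\<^sup>2) = 1"
    unfolding elt_def using root0 by algebra
  hence inv: "inverse (1 - ?t * \<theta>) = elt (1 + ?t ^ 3 * real b) ?t (?t\<^sup>2)"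
    by (rule inverse_unique)
  have "1 - ?t * \<theta> = elt 1 (- ?t) 0" by (simp add: elt_def)
  moreover have "elt 1 (- ?t) 0 \<in> OK" by (subst elt_in_OK_iff) auto
  moreover have "elt (1 + ?t ^ 3 * real b) ?t (?t\<^sup>2) \<in> OK" by (subst elt_in_OK_iff) auto
  ultimately show ?thesis
    unfolding pos_units_def int_units_def using inv theta_less by auto
qed

section \<open>The field is not a pure cubic field\<close>

text \<open>
  Let \<open>M\<^sup>2 = 4 r\<^sup>3 b + 1\<close> with an integer \<open>M = 2 n - 1\<close>. Cardano's formula gives \<open>\<theta>\<close> as the sum of a
  cube root of \<open>b n\<close> and one of \<open>b (1 - n)\<close>. The first of them is
  \<open>(r \<theta>\<^sup>2 + n \<theta> + 2 r\<^sup>2 b) / M\<close>, an algebraic integer of the field, but its coordinate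
  \<open>n / M\<close> is not an integer.
\<close>
lemma discriminant_not_square:
  assumes "m \<in> \<rat>"
  shows "m\<^sup>2 \<noteq> 4 * real r ^ 3 * real b + 1"
proof
  assume sq: "m\<^sup>2 = 4 * real r ^ 3 * real b + 1"
  \<comment> \<open>The positive root is needed below to get \<open>M > 1\<close> and so \<open>0 < n / M < 1\<close>.\<close>
  define M where "M = \<bar>m\<bar>"
  have M: "M \<in> \<rat>" "M \<ge> 0" "M\<^sup>2 = 4 * real r ^ 3 * real b + 1"
    using assms sq by (auto simp: M_def)
  have "sqrt (of_nat (4 * r ^ 3 * b + 1)) = M" using M(2,3) by (intro real_sqrt_unique) simp_all
  moreover have "algebraic_int (sqrt (of_nat (4 * r ^ 3 * b + 1)))" by (intro algebraic_int_sqrt algebraic_int_of_nat)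
  ultimately have "algebraic_int M" by (simp only:)
  hence "M \<in> \<int>" using M(1) by (rule rational_algebraic_int_is_int)
  then obtain k :: int where k: "M = of_int k" by (auto elim: Ints_cases)
  have "real_of_int (k\<^sup>2) = real_of_int (4 * int r ^ 3 * int b + 1)" using M(3) k by simp
  hence "k\<^sup>2 = 4 * int r ^ 3 * int b + 1" by (simp only: of_int_eq_iff)
  hence "odd (k\<^sup>2)" by simp
  hence "odd k" by simp
  then obtain j where j: "k = 2 * j + 1" by (elim oddE)
  define n where "n = real_of_int (j + 1)"
  have Mn: "M = 2 * n - 1" using k j by (simp add: n_def)
  have "4 * real r ^ 3 * real b > 0" using r_ge_1 b_ge_2 by simp
  hence "M\<^sup>2 > 1\<^sup>2" using M(3) by simp
  hence "M > 1" using M(2) by (rule power2_less_imp_less)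
  have nn: "n\<^sup>2 - n - real r ^ 3 * real b = 0" using M(3) Mn by (simp add: power2_eq_square algebra_simps)
  let ?\<alpha> = "elt (2 * real r ^ 2 * real b / M) (n / M) (real r / M)"
  let ?\<beta> = "elt (2 * real r ^ 2 * real b) n (real r)"
  \<comment> \<open>Both multiplications produce a factor \<open>M\<close>, by \<open>n\<^sup>2 - n = r\<^sup>3 b\<close>; this is why dividing by \<open>M\<close> leaves
    an integral cube.\<close>
  have "?\<beta> * ?\<beta> = elt (M * (2 * real r * real b * n)) (M * (- (real r ^ 2 * real b))) (M * n)"
    unfolding elt_mult Mn
    by (intro arg_cong3[of _ _ _ _ _ _ elt]) (use nn in algebra | simp add: algebra_simps power2_eq_square)+
  also have "\<dots> = M * elt (2 * real r * real b * n) (- (real r ^ 2 * real b)) n"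
    by (simp add: elt_def algebra_simps)
  finally have "?\<beta> ^ 3 = M * (elt (2 * real r * real b * n) (- (real r ^ 2 * real b)) n * ?\<beta>)"
    by (simp only: power3_eq_cube mult.assoc)
  also have "elt (2 * real r * real b * n) (- (real r ^ 2 * real b)) n * ?\<beta> = elt (M\<^sup>2 * (real b * n)) 0 0"
    unfolding elt_mult Mn
    by (intro arg_cong3[of _ _ _ _ _ _ elt]) (use nn in algebra | simp add: algebra_simps power2_eq_square)+
  finally have "?\<beta> ^ 3 = M ^ 3 * (real b * n)" by (simp add: elt_def power2_eq_square power3_eq_cube)
  moreover have "?\<alpha> = ?\<beta> / M"
    by (simp add: elt_def add_divide_distrib)
  ultimately have "?\<alpha> ^ 3 = real b * n" using \<open>M > 1\<close> by (simp add: power_divide)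
  hence "?\<alpha> = root 3 (real b * n)" by (simp add: odd_real_root_unique)
  moreover have "real b * n = of_int (int b * (j + 1))" by (simp add: n_def)
  ultimately have "algebraic_int ?\<alpha>"
    by (metis algebraic_int_nth_root_real algebraic_int_of_int)
  moreover have "n \<in> \<rat>" by (simp add: n_def)
  hence rat: "2 * real r ^ 2 * real b / M \<in> \<rat>" "n / M \<in> \<rat>" "real r / M \<in> \<rat>" using M(1) by auto
  ultimately have "?\<alpha> \<in> OK" using elt_in_K by (simp add: ring_of_integers_def)
  hence "n / M \<in> \<int>" using elt_in_OK_iff[OF rat] by blast
  moreover have "0 < n / M" "n / M < 1" using \<open>M > 1\<close> Mn by (auto simp: field_simps)
  ultimately show False by (auto elim!: Ints_cases)
qed

lemma rational_cube_imp_rational: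
  assumes "u \<in> K" "u ^ 3 \<in> \<rat>"
  shows "u \<in> \<rat>"
proof -
  obtain x y z where "u = elt x y z" "x \<in> \<rat>" "y \<in> \<rat>" "z \<in> \<rat>"
    using assms(1) unfolding rat_adjoin_eq by blast
  thus ?thesis using rational_cube_imp_square[of x y z] discriminant_not_square assms(2) by blast
qed

section \<open>The powers of the root as principal factors\<close>

lemma inverse_theta: "inverse \<theta> = elt (3 * real r) 0 (1 / real b)"
proof (rule inverse_unique)
  show "\<theta> * elt (3 * real r) 0 (1 / real b) = 1"
    using root b_ge_2 by (simp add: elt_def field_simps power2_eq_square power3_eq_cube)
qed

lemma inverse_theta_sq:
  "inverse (\<theta>\<^sup>2) = elt (9 * (real r)\<^sup>2) (1 / real b) (3 * real r / real b)"
proof -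
  have "inverse (\<theta>\<^sup>2) = inverse \<theta> * inverse \<theta>" by (simp add: power2_eq_square)
  also have "\<dots> = elt (9 * (real r)\<^sup>2) (1 / real b) (3 * real r / real b)"
    unfolding inverse_theta elt_mult using b_ge_2
    by (intro arg_cong3[of _ _ _ _ _ _ elt]) (simp_all add: field_simps power2_eq_square)
  finally show ?thesis .
qed

lemma inverse_b_not_int: "1 / real b \<notin> \<int>"
proof
  assume "1 / real b \<in> \<int>"
  then obtain i :: int where "1 / real b = of_int i" by (elim Ints_cases)
  moreover have "0 < 1 / real b" "1 / real b < 1" using b_ge_2 by simp_all
  ultimately show False by simp
qed

text \<open>
  If \<open>\<theta>\<^sup>k = q u\<close>, then integrality of \<open>u = \<theta>\<^sup>k / q\<close> makes \<open>1 / q\<close> an integer, and integrality of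
  \<open>inverse u\<close> makes \<open>q / b\<close> an integer, so their product \<open>1 / b\<close> would be one.
\<close>
lemma theta_pow_not_rational_times_unit:
  assumes k: "k = 1 \<or> k = 2" and q: "q \<in> \<rat>" and u: "u \<in> int_units K"
  shows "\<theta> ^ k \<noteq> q * u"
proof
  assume eq: "\<theta> ^ k = q * u"
  have "q \<noteq> 0" using eq theta_pos by auto
  have u': "u = \<theta> ^ k / q" "inverse u = q * inverse (\<theta> ^ k)"
    using eq \<open>q \<noteq> 0\<close> u by (auto simp: int_units_def field_simps)
  have O: "u \<in> OK" "inverse u \<in> OK" using u by (auto simp: int_units_def)
  have "1 / q \<in> \<int> \<and> q / real b \<in> \<int>"
    using k
  proof
    assume "k = 1"
    hence "u = elt 0 (1 / q) 0" "inverse u = elt (3 * real r * q) 0 (q / real b)"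
      using u' by (simp_all add: inverse_theta) (simp_all add: elt_def algebra_simps)
    thus ?thesis using O elt_in_OK_iff[of 0 "1 / q" 0] elt_in_OK_iff[of "3 * real r * q" 0 "q / real b"] q by simp
  next
    assume "k = 2"
    hence "u = elt 0 0 (1 / q)" "inverse u = elt (9 * (real r)\<^sup>2 * q) (q / real b) (3 * real r * q / real b)"
      using u' by (simp_all add: inverse_theta_sq) (simp_all add: elt_def algebra_simps)
    thus ?thesis using O elt_in_OK_iff[of 0 0 "1 / q"]
        elt_in_OK_iff[of "9 * (real r)\<^sup>2 * q" "q / real b" "3 * real r * q / real b"] q by simp
  qed
  hence "1 / q * (q / real b) \<in> \<int>" by (intro Ints_mult) auto
  thus False using inverse_b_not_int \<open>q \<noteq> 0\<close> by simp
qed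

lemma theta_pow_cube: "(\<theta> ^ k) ^ 3 = real b ^ k * (1 - 3 * real r * \<theta>) ^ k"
proof -
  have "(\<theta> ^ k) ^ 3 = (\<theta> ^ 3) ^ k" by (simp only: power_mult[symmetric] mult.commute)
  thus ?thesis unfolding theta_cube power_mult_distrib .
qed

lemma field_norm_theta_pow: "field_norm K (\<theta> ^ k) = real b ^ k"
  using theta_pos by (simp add: field_norm_def conj_norm_theta_pow power_divide)

lemma theta_pow_principal_factor:
  assumes k: "k = 1 \<or> k = 2"
  shows "nonunitary_principal_factor K (\<theta> ^ k)"
  unfolding nonunitary_principal_factor_def
proof (intro conjI notI)
  show "\<theta> ^ k \<in> OK" by (intro OK_power theta_in_OK)
next
  assume "\<theta> ^ k \<in> int_units K"
  thus False using theta_pow_not_rational_times_unit[OF k, of 1] by auto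
next
  have "(\<theta> ^ k) ^ 3 / field_norm K (\<theta> ^ k) = (1 - 3 * real r * \<theta>) ^ k"
    unfolding theta_pow_cube field_norm_theta_pow using b_ge_2 by simp
  thus "(\<theta> ^ k) ^ 3 / field_norm K (\<theta> ^ k) \<in> int_units K"
    using pos_units_power[OF theta_cube_unit, of k] by (simp add: pos_units_def)
next
  assume "\<exists>q\<in>\<rat>. principal_ideal K (\<theta> ^ k) = principal_ideal K q"
  then obtain q where q: "q \<in> \<rat>" "principal_ideal K (\<theta> ^ k) = principal_ideal K q" by blast
  have self: "a \<in> principal_ideal K a" for a
    using int_in_OK[of 1] by (force simp: principal_ideal_def)
  obtain u where u: "\<theta> ^ k = q * u" "u \<in> OK"
    using self[of "\<theta> ^ k"] q(2) by (auto simp: principal_ideal_def)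
  obtain v where v: "q = \<theta> ^ k * v" "v \<in> OK"
    using self[of q] q(2) by (auto simp: principal_ideal_def)
  have "\<theta> ^ k \<noteq> 0" using theta_pos by simp
  hence "u * v = 1" using u(1) v(1) by (metis mult.assoc mult.commute mult_cancel_left1)
  hence "u \<in> int_units K" using u v by (auto simp: int_units_def inverse_unique)
  thus False using theta_pow_not_rational_times_unit[OF k q(1)] u(1) by blast
qed

section \<open>Units modulo cubes\<close>

text \<open>
  The least unit greater than one generates. It exists because the interval between one and a known
  unit contains finitely many units.
\<close>
lemma pos_units_cyclic: "\<exists>\<epsilon>\<in>pos_units K. \<epsilon> > 1 \<and> (\<forall>u\<in>pos_units K. \<exists>n::int. u = \<epsilon> powi n)"
proof -
  define e where "e = inverse (1 - 3 * real r * \<theta>)"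
  have e: "e \<in> pos_units K" unfolding e_def by (intro pos_units_inverse theta_cube_unit)
  have "e > 1" unfolding e_def using theta_pos theta_less r_ge_1 by (simp add: one_less_inverse_iff)
  define S where "S = {u \<in> pos_units K. 1 < u \<and> u \<le> e}"
  have "finite S" using finite_bounded_units[of e] by (rule finite_subset[rotated]) (auto simp: S_def)
  moreover have "S \<noteq> {}" using e \<open>e > 1\<close> by (auto simp: S_def)
  ultimately have \<epsilon>S: "Min S \<in> S" and min: "\<And>u. u \<in> S \<Longrightarrow> Min S \<le> u" by auto
  define \<epsilon> where "\<epsilon> = Min S"
  have \<epsilon>: "\<epsilon> \<in> pos_units K" "\<epsilon> > 1" "\<epsilon> \<le> e" using \<epsilon>S by (auto simp: \<epsilon>_def S_def)
  have least: "\<epsilon> \<le> u" if "u \<in> pos_units K" "u > 1" for u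
    using min[of u] that \<epsilon>(3) by (cases "u \<le> e") (auto simp: S_def \<epsilon>_def)
  have "\<exists>n::int. u = \<epsilon> powi n" if u: "u \<in> pos_units K" for u
  proof -
    have "u > 0" using u by (simp add: pos_units_def)
    define n where "n = \<lfloor>log \<epsilon> u\<rfloor>"
    have "\<epsilon> powr n \<le> u" "u < \<epsilon> powr (n + 1)"
      using \<open>u > 0\<close> \<epsilon>(2) floor_correct[of "log \<epsilon> u"]
      by (simp_all add: n_def powr_le_iff less_powr_iff)
    hence b: "\<epsilon> powi n \<le> u" "u < \<epsilon> powi n * \<epsilon>"
      using \<epsilon>(2) powr_real_of_int'[of \<epsilon> n] by (simp_all add: powr_add)
    have pos: "\<epsilon> powi n > 0" using \<epsilon>(2) by simp
    define w where "w = u * inverse (\<epsilon> powi n)"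
    have w: "w \<in> pos_units K" unfolding w_def by (intro pos_units_mult pos_units_inverse pos_units_powi u \<epsilon>)
    have "1 \<le> w" "w < \<epsilon>" using b pos by (auto simp: w_def field_simps)
    hence "w = 1" using least[OF w] by linarith
    hence "u = \<epsilon> powi n" using pos by (simp add: w_def field_simps)
    thus ?thesis ..
  qed
  thus ?thesis using \<epsilon> by blast
qed

text \<open>
  In a cyclic group a non-cube \<open>e\<close> generates the quotient by the cubes, which has order at most three.
\<close>
lemma pos_units_mod_cubes:
  assumes v: "v \<in> pos_units K" and e: "e \<in> pos_units K" and nocube: "\<And>u. u \<in> pos_units K \<Longrightarrow> u ^ 3 \<noteq> e"
  shows "\<exists>k\<in>{0, 1, 2}. \<exists>w\<in>pos_units K. v = e ^ k * w ^ 3"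
proof -
  obtain \<epsilon> where \<epsilon>: "\<epsilon> \<in> pos_units K" "\<epsilon> > 1" "\<And>u. u \<in> pos_units K \<Longrightarrow> \<exists>n::int. u = \<epsilon> powi n"
    using pos_units_cyclic by blast
  obtain m n :: int where mn: "e = \<epsilon> powi m" "v = \<epsilon> powi n" using \<epsilon>(3) v e by meson
  have m3: "m mod 3 \<noteq> 0"
  proof
    assume "m mod 3 = 0"
    then obtain j where "m = j * 3" by (auto simp: mod_eq_0_iff_dvd elim: dvdE)
    hence "(\<epsilon> powi j) ^ 3 = e" by (simp add: mn power_int_mult)
    thus False using nocube[OF pos_units_powi[OF \<epsilon>(1)]] by blast
  qed
  \<comment> \<open>Solve \<open>m k \<equiv> n\<close> modulo \<open>3\<close>; \<open>m\<close> is its own inverse there.\<close>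
  define k where "k = nat ((n * m) mod 3)"
  have k: "int k = (n * m) mod 3" by (simp add: k_def)
  have "m mod 3 = 1 \<or> m mod 3 = 2" using m3 by presburger
  hence "(m * m) mod 3 = 1" by (auto simp: mod_mult_eq[of m 3 m, symmetric])
  have "(m * int k) mod 3 = (n * (m * m)) mod 3" unfolding k by (simp add: mod_simps algebra_simps)
  also have "\<dots> = n mod 3" using \<open>(m * m) mod 3 = 1\<close> by (metis mod_mult_right_eq mult.right_neutral)
  finally have "3 dvd n - m * int k" by (metis mod_eq_dvd_iff)
  then obtain j where j: "n = m * int k + j * 3" by (metis add.commute diff_add_cancel dvdE mult.commute)
  have "v = \<epsilon> powi (m * int k) * \<epsilon> powi (j * 3)" unfolding mn j using \<epsilon>(2) by (intro power_int_add) auto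
  also have "\<dots> = e ^ k * (\<epsilon> powi j) ^ 3" by (simp add: mn power_int_mult)
  finally have "v = e ^ k * (\<epsilon> powi j) ^ 3" .
  moreover have "k < 3" using k by (simp add: k_def nat_less_iff)
  hence "k \<in> {0, 1, 2}" by auto
  ultimately show ?thesis using pos_units_powi[OF \<epsilon>(1)] by blast
qed

text \<open>
  Otherwise \<open>\<theta>\<close> divided by a unit would be a cube root of \<open>b\<close>, hence rational.
\<close>
lemma theta_cube_unit_not_cube:
  assumes "u \<in> pos_units K"
  shows "u ^ 3 \<noteq> 1 - 3 * real r * \<theta>"
proof
  assume eq: "u ^ 3 = 1 - 3 * real r * \<theta>"
  have u: "u > 0" "u \<in> int_units K" "inverse u \<in> OK"
    using assms by (auto simp: pos_units_def int_units_def)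
  have "\<theta> ^ 3 = real b * u ^ 3" unfolding eq by (rule theta_cube)
  hence "(\<theta> * inverse u) ^ 3 = real b * (u * inverse u) ^ 3"
    by (simp only: power_mult_distrib mult.assoc)
  hence cube: "(\<theta> * inverse u) ^ 3 = real b" using u(1) by simp
  have "\<theta> * inverse u \<in> K" by (intro OK_subset OK_mult theta_in_OK u)
  hence rat: "\<theta> * inverse u \<in> \<rat>" by (rule rational_cube_imp_rational) (simp only: cube Rats_of_nat)
  have "\<theta> ^ 1 = (\<theta> * inverse u) * u" using u(1) by simp
  thus False using theta_pow_not_rational_times_unit[OF disjI1[OF refl] rat u(2)] by blast
qed

section \<open>Classification of the principal factors among the minima\<close>

lemma principal_factor_cases:
  assumes \<alpha>: "\<alpha> > 0" "nonunitary_principal_factor K \<alpha>"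
  obtains k w q where "k = 1 \<or> k = 2" "w \<in> pos_units K" "q \<in> \<rat>" "q > 0" "\<alpha> = q * (\<theta> ^ k * w)"
proof -
  let ?N = "field_norm K \<alpha>"
  have O: "\<alpha> \<in> OK" and v: "\<alpha> ^ 3 / ?N \<in> int_units K"
    and nonrat: "\<And>q. q \<in> \<rat> \<Longrightarrow> principal_ideal K \<alpha> \<noteq> principal_ideal K q"
    using \<alpha>(2) by (auto simp: nonunitary_principal_factor_def)
  have N: "?N > 0" using \<alpha>(1) conj_norm_pos[of \<alpha>] OK_subset[OF O] by (simp add: field_norm_def)
  have NQ: "?N \<in> \<rat>" using field_norm_int[OF O] Ints_subset_Rats by blast
  have "\<alpha> ^ 3 / ?N \<in> pos_units K" using v N \<alpha>(1) by (simp add: pos_units_def)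
  from pos_units_mod_cubes[OF this theta_cube_unit theta_cube_unit_not_cube]
  obtain k w where k: "k \<in> {0, 1, 2}" and w: "w \<in> pos_units K"
    and eq: "\<alpha> ^ 3 / ?N = (1 - 3 * real r * \<theta>) ^ k * w ^ 3" by blast
  have w': "w > 0" "w \<in> OK" "inverse w \<in> OK" using w by (auto simp: pos_units_def int_units_def)
  define q where "q = \<alpha> * inverse (\<theta> ^ k * w)"
  have \<alpha>_eq: "\<alpha> = q * (\<theta> ^ k * w)" using w'(1) theta_pos by (simp add: q_def field_simps)
  have "q > 0" using w'(1) theta_pos \<alpha>(1) by (simp add: q_def)
  have thk: "(\<theta> ^ k) ^ 3 > 0" using theta_pos by simp
  have "q ^ 3 * ((\<theta> ^ k) ^ 3 * w ^ 3) = \<alpha> ^ 3" unfolding \<alpha>_eq by (simp add: power_mult_distrib)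
  also have "\<dots> = ?N * ((1 - 3 * real r * \<theta>) ^ k * w ^ 3)" using eq N by (simp add: field_simps)
  finally have "q ^ 3 * real b ^ k * ((1 - 3 * real r * \<theta>) ^ k * w ^ 3) = ?N * ((1 - 3 * real r * \<theta>) ^ k * w ^ 3)"
    unfolding theta_pow_cube by (simp add: mult_ac)
  hence "q ^ 3 * real b ^ k = ?N" using w'(1) theta_less by simp
  hence "q ^ 3 = ?N / real b ^ k" using b_ge_2 by (simp add: field_simps)
  hence q3: "q ^ 3 \<in> \<rat>" using NQ by simp
  have "inverse \<theta> \<in> K" unfolding inverse_theta by (intro elt_in_K) auto
  have "inverse (\<theta> ^ k) \<in> K"
    using k \<open>inverse \<theta> \<in> K\<close> elt_in_K[of 1 0 0] inverse_theta_sq elt_in_K[of "9 * (real r)\<^sup>2" "1 / real b" "3 * real r / real b"]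
    by (auto simp: elt_def)
  hence "\<alpha> * inverse w * inverse (\<theta> ^ k) \<in> K"
    using OK_subset[OF OK_mult[OF O w'(3)]] by (simp add: K_mult)
  hence "q \<in> K" by (simp add: q_def mult_ac)
  hence q: "q \<in> \<rat>" using q3 by (rule rational_cube_imp_rational)
  have "k \<noteq> 0"
  proof
    assume "k = 0"
    hence "\<alpha> = q * w" using \<alpha>_eq by simp
    have "principal_ideal K \<alpha> = principal_ideal K q"
      unfolding principal_ideal_def
    proof (intro equalityI image_subsetI)
      fix x assume "x \<in> OK"
      hence "w * x \<in> OK" by (intro OK_mult w')
      thus "\<alpha> * x \<in> (\<lambda>x. q * x) ` OK" unfolding \<open>\<alpha> = q * w\<close> mult.assoc by (rule imageI)
    next
      fix x assume "x \<in> OK"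
      hence "inverse w * x \<in> OK" by (intro OK_mult w')
      moreover have "q * x = \<alpha> * (inverse w * x)" unfolding \<open>\<alpha> = q * w\<close> using w'(1) by simp
      ultimately show "q * x \<in> (\<lambda>x. \<alpha> * x) ` OK" by blast
    qed
    thus False using nonrat q by blast
  qed
  hence "k = 1 \<or> k = 2" using k by auto
  thus ?thesis using that w q \<open>q > 0\<close> \<alpha>_eq by blast
qed

text \<open>
  If \<open>q \<ge> 2\<close>, then \<open>u\<close> itself is smaller than \<open>q u\<close> at both places.
\<close>
lemma rational_multiple_minimum:
  assumes min: "q * u \<in> lattice_minima K" and q: "q \<in> \<int>" "q > 0" and u: "u \<in> OK" "u > 0"
  shows "q = 1"
proof (rule ccontr)
  assume "q \<noteq> 1"
  moreover obtain n :: int where n: "q = of_int n" using q(1) by (auto elim: Ints_cases)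
  ultimately have "q > 1" using q(2) by simp
  have "u < q * u" using \<open>q > 1\<close> u(2) by simp
  moreover have "conj_norm K u < conj_norm K (q * u)"
  proof -
    have "conj_norm K (q * u) = q\<^sup>2 * conj_norm K u"
      using conj_norm_mult[of q u] conj_norm_rat[of q] rat_in_K[of q] OK_subset[OF u(1)] n by simp
    moreover have "q\<^sup>2 > 1" using \<open>q > 1\<close> by (simp add: one_less_power)
    ultimately show ?thesis using conj_norm_pos[of u] u OK_subset[OF u(1)] by simp
  qed
  ultimately show False using min u by (auto simp: lattice_minima_def)
qed

lemma principal_factor_minimum:
  assumes min: "\<alpha> \<in> lattice_minima K" and dpf: "nonunitary_principal_factor K \<alpha>"
  obtains k w where "k = 1 \<or> k = 2" "w \<in> pos_units K" "\<alpha> = w * \<theta> ^ k"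
proof -
  have \<alpha>: "\<alpha> > 0" "\<alpha> \<in> OK" using min by (auto simp: lattice_minima_def)
  obtain k w q where *: "k = 1 \<or> k = 2" "w \<in> pos_units K" "q \<in> \<rat>" "q > 0" "\<alpha> = q * (\<theta> ^ k * w)"
    using principal_factor_cases[OF \<alpha>(1) dpf] .
  have w: "w > 0" "w \<in> OK" "inverse w \<in> OK" using *(2) by (auto simp: pos_units_def int_units_def)
  have "q * \<theta> ^ k = \<alpha> * inverse w" using w(1) by (simp add: *(5))
  hence O: "q * \<theta> ^ k \<in> OK" using OK_mult[OF \<alpha>(2) w(3)] by simp
  have "q \<in> \<int>"
    using *(1)
  proof
    assume "k = 1"
    thus ?thesis using O elt_in_OK_iff[of 0 q 0] *(3) by (simp add: elt_def)
  next
    assume "k = 2"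
    thus ?thesis using O elt_in_OK_iff[of 0 0 q] *(3) by (simp add: elt_def)
  qed
  moreover have "\<theta> ^ k * w \<in> OK" by (intro OK_mult OK_power theta_in_OK w)
  moreover have "\<theta> ^ k * w > 0" using theta_pos w(1) by simp
  ultimately have "q = 1" using rational_multiple_minimum min *(4,5) by blast
  thus ?thesis using that *(1,2,5) by (simp add: mult.commute)
qed

section \<open>The powers of the root as lattice minima\<close>

text \<open>
  The assumption \<open>basis\<close> says that \<open>\<theta>\<^sup>-\<^sup>k \<int>[\<theta>]\<close> is contained in the lattice spanned by
  \<open>1, \<theta>/c, \<theta>\<^sup>2/b\<close>, in which \<open>1\<close> is minimal. Multiplication by \<open>\<theta>\<^sup>k\<close> preserves both comparisons.
\<close>
lemma theta_pow_minimum_criterion: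
  assumes c: "0 < c" "c\<^sup>2 \<le> 3 * real r * real b" "c \<in> \<rat>"
    and basis: "\<And>x y z. x \<in> \<int> \<Longrightarrow> y \<in> \<int> \<Longrightarrow> z \<in> \<int> \<Longrightarrow>
      \<exists>X\<in>\<int>. \<exists>Y\<in>\<int>. \<exists>Z\<in>\<int>. elt x y z = \<theta> ^ k * elt X (Y / c) (Z / real b)"
  shows "\<theta> ^ k \<in> lattice_minima K"
  unfolding lattice_minima_def
proof (intro CollectI conjI notI)
  show "\<theta> ^ k \<in> OK" by (intro OK_power theta_in_OK)
  show pos: "\<theta> ^ k > 0" using theta_pos by simp
  assume "\<exists>\<nu>\<in>OK. \<nu> \<noteq> 0 \<and> \<bar>\<nu>\<bar> < \<theta> ^ k \<and> conj_norm K \<nu> < conj_norm K (\<theta> ^ k)"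
  \<comment> \<open>Divide a counterexample by \<open>\<theta>\<^sup>k\<close>.\<close>
  then obtain \<nu> where \<nu>: "\<nu> \<in> OK" "\<nu> \<noteq> 0" "\<bar>\<nu>\<bar> < \<theta> ^ k" "conj_norm K \<nu> < conj_norm K (\<theta> ^ k)"
    by blast
  obtain x y z where xyz: "\<nu> = elt x y z" "x \<in> \<int>" "y \<in> \<int>" "z \<in> \<int>"
    using \<nu>(1) by (rule OK_cases)
  from basis[OF xyz(2-4)] obtain X Y Z where int: "X \<in> \<int>" "Y \<in> \<int>" "Z \<in> \<int>"
    and eq: "\<nu> = \<theta> ^ k * elt X (Y / c) (Z / real b)"
    unfolding xyz(1) by blast
  have rat: "X \<in> \<rat>" "Y / c \<in> \<rat>" "Z / real b \<in> \<rat>"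
    using int[THEN Ints_subset_Rats[THEN subsetD]] c(3) by simp_all
  have "conj_norm K \<nu> = conj_norm K (\<theta> ^ k) * cnorm X (Y / c) (Z / real b)"
    unfolding eq using conj_norm_mult[OF theta_pow_in_K elt_in_K[OF rat]] conj_norm_elt[OF rat] by simp
  moreover have "conj_norm K (\<theta> ^ k) > 0" by (rule conj_norm_pos[OF theta_pow_in_K]) (use theta_pos in simp)
  ultimately have "cnorm X (Y / c) (Z / real b) < 1" using \<nu>(4) by simp
  moreover have "\<bar>elt X (Y / c) (Z / real b)\<bar> < 1" using \<nu>(3) pos by (simp add: eq abs_mult)
  ultimately have "X = 0 \<and> Y = 0 \<and> Z = 0" using one_minimal[OF c(1,2) int] by blast
  hence "\<nu> = 0" by (simp add: eq elt_def)
  thus False using \<nu>(2) by blast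
qed

lemma theta_minimum: "\<theta> \<in> lattice_minima K"
proof -
  have "\<theta> ^ 1 \<in> lattice_minima K"
  proof (rule theta_pow_minimum_criterion[where c = 1])
    show "1\<^sup>2 \<le> 3 * real r * real b" using rb_ge by simp
    fix x y z :: real assume *: "x \<in> \<int>" "y \<in> \<int>" "z \<in> \<int>"
    have "real b * elt x y z = \<theta> * elt (real b * (y + 3 * real r * x)) (real b * z) x"
      unfolding elt_def using root0 by algebra
    also have "\<dots> = real b * (\<theta> ^ 1 * elt (y + 3 * real r * x) (z / 1) (x / real b))"
      using b_ge_2 by (simp add: elt_def field_simps)
    finally have "elt x y z = \<theta> ^ 1 * elt (y + 3 * real r * x) (z / 1) (x / real b)"
      using b_ge_2 by simp
    moreover have "y + 3 * real r * x \<in> \<int>" using * by simp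
    ultimately show "\<exists>X\<in>\<int>. \<exists>Y\<in>\<int>. \<exists>Z\<in>\<int>. elt x y z = \<theta> ^ 1 * elt X (Y / 1) (Z / real b)"
      using * by blast
  qed auto
  thus ?thesis by simp
qed

lemma theta_sq_minimum:
  assumes "b \<le> 3 * r"
  shows "\<theta>\<^sup>2 \<in> lattice_minima K"
proof (rule theta_pow_minimum_criterion[where c = "real b"])
  have "real b * real b \<le> real (3 * r) * real b" using assms by (intro mult_right_mono) simp_all
  thus "(real b)\<^sup>2 \<le> 3 * real r * real b" by (simp add: power2_eq_square)
  fix x y z :: real assume *: "x \<in> \<int>" "y \<in> \<int>" "z \<in> \<int>"
  let ?t = "3 * real r"
  have "real b * elt x y z = \<theta>\<^sup>2 * elt (real b * (z + ?t * y + ?t\<^sup>2 * x)) x (y + ?t * x)"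
    unfolding elt_def using root0 by algebra
  also have "\<dots> = real b * (\<theta>\<^sup>2 * elt (z + ?t * y + ?t\<^sup>2 * x) (x / real b) ((y + ?t * x) / real b))"
    using b_ge_2 by (simp add: elt_def field_simps)
  finally have "elt x y z = \<theta>\<^sup>2 * elt (z + ?t * y + ?t\<^sup>2 * x) (x / real b) ((y + ?t * x) / real b)"
    using b_ge_2 by simp
  moreover have "z + ?t * y + ?t\<^sup>2 * x \<in> \<int>" "y + ?t * x \<in> \<int>" using * by simp_all
  ultimately show "\<exists>X\<in>\<int>. \<exists>Y\<in>\<int>. \<exists>Z\<in>\<int>. elt x y z = \<theta>\<^sup>2 * elt X (Y / real b) (Z / real b)"
    using *(1) by blast
qed (use b_ge_2 in auto)

section \<open>Counting the orbits\<close>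

definition orbit :: "real \<Rightarrow> real set" where
  "orbit \<alpha> = (\<lambda>u. u * \<alpha>) ` pos_units K"

lemma orbit_mult:
  assumes "w \<in> pos_units K"
  shows "orbit (w * \<alpha>) = orbit \<alpha>"
  unfolding orbit_def
proof (intro equalityI image_subsetI)
  fix u assume "u \<in> pos_units K"
  hence "u * w \<in> pos_units K" using assms by (rule pos_units_mult)
  thus "u * (w * \<alpha>) \<in> (\<lambda>u. u * \<alpha>) ` pos_units K" unfolding mult.assoc[symmetric] by (rule imageI)
next
  fix u assume "u \<in> pos_units K"
  hence "u * inverse w \<in> pos_units K" using pos_units_inverse[OF assms] by (rule pos_units_mult)
  moreover have "u * \<alpha> = u * inverse w * (w * \<alpha>)" using assms by (simp add: pos_units_def)
  ultimately show "u * \<alpha> \<in> (\<lambda>u. u * (w * \<alpha>)) ` pos_units K" by blast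
qed

lemma orbits_distinct: "orbit \<theta> \<noteq> orbit (\<theta>\<^sup>2)"
proof
  assume eq: "orbit \<theta> = orbit (\<theta>\<^sup>2)"
  have "\<theta> \<in> orbit \<theta>" unfolding orbit_def by (rule image_eqI[OF _ one_in_pos_units]) simp
  with eq obtain u where u: "u \<in> pos_units K" "\<theta> = u * \<theta>\<^sup>2" by (auto simp: orbit_def)
  hence "\<theta> ^ 1 = 1 * inverse u" using theta_pos by (simp add: power2_eq_square field_simps pos_units_def)
  moreover have "inverse u \<in> int_units K" using pos_units_inverse[OF u(1)] by (simp add: pos_units_def)
  ultimately show False using theta_pow_not_rational_times_unit[OF disjI1[OF refl] Rats_1] by blast
qed

lemma principal_factor_orbits_eq:
  "principal_factor_orbits K = orbit ` {\<alpha>. \<alpha> \<in> lattice_minima K \<and> nonunitary_principal_factor K \<alpha>}"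
  by (auto simp: principal_factor_orbits_def orbit_def)

lemma principal_factor_orbits_subset: "principal_factor_orbits K \<subseteq> {orbit \<theta>, orbit (\<theta>\<^sup>2)}"
proof
  fix A assume "A \<in> principal_factor_orbits K"
  then obtain \<alpha> where \<alpha>: "\<alpha> \<in> lattice_minima K" "nonunitary_principal_factor K \<alpha>" "A = orbit \<alpha>"
    unfolding principal_factor_orbits_eq by blast
  obtain k w where "k = 1 \<or> k = 2" "w \<in> pos_units K" "\<alpha> = w * \<theta> ^ k"
    using principal_factor_minimum[OF \<alpha>(1,2)] .
  thus "A \<in> {orbit \<theta>, orbit (\<theta>\<^sup>2)}" using \<alpha>(3) orbit_mult by auto
qed

lemma orbit_theta_in: "orbit \<theta> \<in> principal_factor_orbits K"
  unfolding principal_factor_orbits_eq using theta_minimum theta_pow_principal_factor[of 1] by simp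

lemma M1_or_M2_chain: "M_chain 1 K (minima_chain K) \<or> M_chain 2 K (minima_chain K)"
proof -
  have "principal_factor_orbits K = {orbit \<theta>} \<or> principal_factor_orbits K = {orbit \<theta>, orbit (\<theta>\<^sup>2)}"
    using principal_factor_orbits_subset orbit_theta_in by blast
  thus ?thesis by (elim disjE) (simp_all add: M_chain_def orbits_distinct)
qed

lemma M2_chain:
  assumes "b \<le> 3 * r"
  shows "M_chain 2 K (minima_chain K)"
proof -
  have "orbit (\<theta>\<^sup>2) \<in> principal_factor_orbits K"
    unfolding principal_factor_orbits_eq
    using theta_sq_minimum[OF assms] theta_pow_principal_factor[of 2] by simp
  hence "principal_factor_orbits K = {orbit \<theta>, orbit (\<theta>\<^sup>2)}"
    using principal_factor_orbits_subset orbit_theta_in by blast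
  thus ?thesis by (simp add: M_chain_def orbits_distinct)
qed

end

theorem corollary2:
  fixes r b :: nat and P :: "int poly" and \<theta> :: real and L :: "real set"
  assumes "r \<ge> 1" and "b \<ge> 2" and "squarefree b"
    and "P = [:- int b, 3 * int r * int b, 0, 1:]"
    and "poly (map_poly of_int P) \<theta> = 0"
    and "monogenic P \<theta>"
    and "L = rat_adjoin \<theta>"
  shows "(real r \<ge> real b * root 3 (real b ^ 2 / 4) \<longrightarrow> M_chain 2 L (minima_chain L)) \<and>
         real b * root 3 (real b ^ 2 / 4) > root 3 (real b / 4) \<and>
         (real r \<ge> root 3 (real b / 4) \<longrightarrow>
            M_chain 1 L (minima_chain L) \<or> M_chain 2 L (minima_chain L))"
proof -
  interpret monogenic_cubic_root r b \<theta>
  proof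
    show "\<theta> ^ 3 + 3 * real r * real b * \<theta> = real b"
      using assms(4,5) by (simp add: map_poly_pCons algebra_simps power3_eq_cube)
    show "int_adjoin \<theta> = ring_of_integers (rat_adjoin \<theta>)"
      using assms(6) by (simp add: monogenic_def)
  qed (use assms in auto)
  \<comment> \<open>As \<open>b \<ge> 2\<close>, the cube root in the first bound is at least one, so that bound gives \<open>r \<ge> b\<close>.\<close>
  have b2: "real b ^ 2 \<ge> 4" using assms(2) power_mono[of 2 "real b" 2] by simp
  hence root_ge: "root 3 (real b ^ 2 / 4) \<ge> 1" by simp
  have "b \<le> 3 * r" if "real r \<ge> real b * root 3 (real b ^ 2 / 4)"
  proof -
    have "real b * 1 \<le> real b * root 3 (real b ^ 2 / 4)" using root_ge by (intro mult_left_mono) auto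
    thus ?thesis using that by linarith
  qed
  moreover have "root 3 (real b / 4) < real b * root 3 (real b ^ 2 / 4)"
  proof -
    have "root 3 (real b / 4) < root 3 (real b ^ 2 / 4)"
      using assms(2) by (simp add: power2_eq_square)
    also have "\<dots> \<le> real b * root 3 (real b ^ 2 / 4)"
      using root_ge assms(2) by simp
    finally show ?thesis .
  qed
  ultimately show ?thesis using M1_or_M2_chain M2_chain by (simp add: assms(7))
qed

end
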